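(* Let $n\ge2$, $E=\{1,2,\dots,n\}$, and let $X=((X_t)_{t\ge0},(P_i)_{i\in E})$ be a continuous-time Markov chain with state space $E$, lifetime $\zeta$ and $Q$-matrix $Q=(q_{ij})_{i,j\in E}$ satisfying: (1) $0<-q_{ii}<\infty$ for all $i\in E$; (2) $q_{ij}>0$ for all $i,j\in E$ with $i\neq j$; (3) $\sum_{j\in E}q_{ij}\le 0$ for all $i\in E$. Let $L_t$ be the normalized occupation time distribution of $X$, let $\mathcal{P}_1(E)$ be the set of all probability measures on $E$, and for $\mu\in\mathcal{P}_1(E)$ let $$I(\mu)=-\inf_{u>0}\sum_{i\in E}\frac{Qu(i)}{u(i)}\,\mu(\{i\}).$$ Then for each open set $G$ of $\mathcal{P}_1(E)$, $$\liminf_{t\to\infty}\frac1t\log P_i(L_t\in G,\ t<\zeta)\ \ge\ -\inf_{\mu\in G}I(\mu)\qquad\text{for all } i\in E,$$ and for each closed set $K$ of $\mathcal{P}_1(E)$, $$\limsup_{t\to\infty}\frac1t\log P_i(L_t\in K,\ t<\zeta)\ \le\ -\inf_{\mu\in K}I(\mu)\qquad\text{for all } i\in E.$$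
   Context: The chain $X$ may have finite lifetime: it is killed at the random time $\zeta\in(0,\infty]$, after which it is no longer in $E$ (it is in a cemetery state); under $P_i$ it starts at $i$, and its transition function on $E$ is generated by $Q$, i.e. $P_i(X_t=j,\ t<\zeta)=(e^{tQ})_{ij}$ for $i,j\in E$, $t\ge 0$. The matrix $Q$ is not assumed conservative or symmetric. For $t>0$, the normalized occupation time distribution is $L_t(A)=\frac1t\int_0^t 1_A(X_s)\,ds$ for $A\subset E$; on the event $\{t<\zeta\}$ it is a probability measure on $E$. A function $u:E\to\mathbb{R}$ is identified with the vector $(u(1),\dots,u(n))^T$; $u>0$ means $u(i)>0$ for every $i\in E$; and $Qu(i)=\sum_{j\in E}q_{ij}u(j)$. The infimum in $I(\mu)$ is over all functions $u$ on $E$ with $u>0$. $\mathcal{P}_1(E)$ carries its usual (weak) topology, i.e. the Euclidean topology of the probability simplex in $\mathbb{R}^n$. Conventions: $\log 0=-\infty$ and $\inf\emptyset=+\infty$. *)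

theory Defs
  imports "HOL-Probability.Probability"
begin

text \<open>
  The state space \<open>E\<close> is a finite type \<open>'n\<close>. Functions on \<open>E\<close> and measures on \<open>E\<close> are vectors in
  \<open>real ^ 'n\<close>, a measure \<open>\<mu>\<close> being given by its point masses \<open>\<mu> $ i\<close>. The space of probability
  measures is then the standard simplex, with the subspace topology.
\<close>

definition prob_simplex :: "(real ^ 'n::finite) set" where
  "prob_simplex = {\<mu>. (\<forall>i. 0 \<le> \<mu> $ i) \<and> (\<Sum>i\<in>UNIV. \<mu> $ i) = 1}"


text \<open>
  The multiplication of the type \<open>real ^ 'n ^ 'n\<close>, and with it the power operation, is
  componentwise; the matrix exponential therefore needs its own power function.
\<close>

primrec mat_power :: "real ^ 'n ^ 'n \<Rightarrow> nat \<Rightarrow> real ^ 'n ^ 'n::finite" where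
  "mat_power A 0 = mat 1"
| "mat_power A (Suc k) = A ** mat_power A k"

definition mat_exp :: "real ^ 'n ^ 'n \<Rightarrow> real ^ 'n ^ 'n::finite" where
  "mat_exp A = (\<Sum>k. (1 / fact k) *\<^sub>R mat_power A k)"


definition natural_filtration ::
    "'a measure \<Rightarrow> (real \<Rightarrow> 'a \<Rightarrow> 'b) \<Rightarrow> real \<Rightarrow> 'a measure" where
  "natural_filtration M X s = sigma (space M) {X r -` A \<inter> space M | r A. 0 \<le> r \<and> r \<le> s}"

text \<open>
  A continuous-time Markov chain on \<open>'n\<close> with lifetime \<open>\<zeta>\<close> and Q-matrix \<open>Q\<close>. The value \<open>None\<close> is the
  cemetery state. Only times \<open>t \<ge> 0\<close> are relevant. The measurable space \<open>M\<close> carries all the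
  measures \<open>P i\<close>; its own measure plays no role. Instead of right-continuity of the paths we only
  ask for joint measurability in time and sample point (which right-continuity implies), so that
  occupation times are defined.
\<close>

locale killed_markov_chain =
  fixes M :: "'a measure"
    and P :: "'n::finite \<Rightarrow> 'a measure"
    and X :: "real \<Rightarrow> 'a \<Rightarrow> 'n option"
    and \<zeta> :: "'a \<Rightarrow> ereal"
    and Q :: "real ^ 'n ^ 'n"
  assumes prob_space_P: "\<And>i. prob_space (P i)"
    and sets_P: "\<And>i. sets (P i) = sets M"
    and measurable_X:
      "(\<lambda>(t, \<omega>). X t \<omega>) \<in> restrict_space borel {0..} \<Otimes>\<^sub>M M \<rightarrow>\<^sub>M count_space UNIV"
    and lifetime_pos: "\<And>\<omega>. \<omega> \<in> space M \<Longrightarrow> 0 < \<zeta> \<omega>"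
    and alive_iff: "\<And>t \<omega>. 0 \<le> t \<Longrightarrow> \<omega> \<in> space M \<Longrightarrow> X t \<omega> \<noteq> None \<longleftrightarrow> ereal t < \<zeta> \<omega>"
    and start: "\<And>i. AE \<omega> in P i. X 0 \<omega> = Some i"
    and markov: "\<And>i k s t. 0 \<le> s \<Longrightarrow> 0 \<le> t \<Longrightarrow>
      AE \<omega> in P i.
        real_cond_exp (P i) (natural_filtration M X s) (indicator {\<omega>'. X (s + t) \<omega>' = Some k}) \<omega>
        = (case X s \<omega> of None \<Rightarrow> 0
           | Some j \<Rightarrow> measure (P j) {\<omega>' \<in> space M. X t \<omega>' = Some k})"
    and transition: "\<And>i j t. 0 \<le> t \<Longrightarrow>
      measure (P i) {\<omega> \<in> space M. X t \<omega> = Some j \<and> ereal t < \<zeta> \<omega>} = mat_exp (t *\<^sub>R Q) $ i $ j"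


definition occupation :: "(real \<Rightarrow> 'a \<Rightarrow> 'n option) \<Rightarrow> real \<Rightarrow> 'a \<Rightarrow> 'n set \<Rightarrow> real" where
  "occupation X t \<omega> A = 1 / t * (LINT s:{0..t}|lborel. indicator (Some ` A) (X s \<omega>))"

definition occupation_vec :: "(real \<Rightarrow> 'a \<Rightarrow> 'n option) \<Rightarrow> real \<Rightarrow> 'a \<Rightarrow> real ^ 'n::finite" where
  "occupation_vec X t \<omega> = (\<chi> j. occupation X t \<omega> {j})"

definition rate :: "real ^ 'n ^ 'n \<Rightarrow> real ^ 'n::finite \<Rightarrow> ereal" where
  "rate Q \<mu> = - (INF u\<in>{u :: real ^ 'n. \<forall>i. 0 < u $ i}.
                   ereal (\<Sum>i\<in>UNIV. (Q *v u) $ i / u $ i * \<mu> $ i))"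


text \<open>Logarithm of a nonnegative real with \<open>log 0 = -\<infinity>\<close> (the library has \<open>ln 0 = 0\<close>).\<close>

definition elog :: "real \<Rightarrow> ereal" where
  "elog p = (if p = 0 then - \<infinity> else ereal (ln p))"

end

theory Submission
  imports Defs
begin

text \<open>
  For a positive function \<open>u\<close> put \<open>V = - Qu / u\<close>, so that \<open>(Q + V) u = 0\<close>. Then
  \<open>I(\<mu>)\<close> is the supremum of \<open>\<langle>V, \<mu>\<rangle>\<close> over all such potentials \<open>V\<close>, and everything rests on the
  Feynman-Kac identity (\<open>feynman_kac_harmonic\<close>)

    \<open>E\<^sub>i [exp (\<integral>\<^sub>0\<^sup>t V(X\<^sub>s) ds) u(X\<^sub>t); t < \<zeta>] = u(i)\<close>,

  in which the exponent is \<open>t \<langle>V, L\<^sub>t\<rangle>\<close>. Since paths are only assumed to be measurable, it is proved by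
  discretisation and not by stochastic calculus: along the grid \<open>k h\<close> the Markov property turns the
  expectation into an iterated product of the operators \<open>exp(h V) exp(h Q)\<close>, each of which moves \<open>u\<close> by
  only \<open>O(h\<^sup>2)\<close>, while the Riemann sums converge to the integral in \<open>L\<^sup>1\<close>, because the state changes
  within time \<open>h\<close> with probability \<open>O(h)\<close>.

  The identity gives an exponential bound on compact sets (\<open>exponential_decay\<close>). Let \<open>W\<close> be a
  function on the states such that at every point \<open>\<mu>\<close> of a compact set \<open>C\<close> some potential \<open>V\<close> as above
  beats \<open>W\<close>, that is, \<open>\<langle>W, \<mu>\<rangle> < \<langle>V, \<mu>\<rangle>\<close>. Covering \<open>C\<close> by finitely many neighbourhoods, one
  finds that \<open>E\<^sub>i [exp (t \<langle>W, L\<^sub>t\<rangle>); L\<^sub>t \<in> C, t < \<zeta>]\<close> decays exponentially. Both halves of the theorem are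
  instances of this.

  For the upper bound, take \<open>C = K\<close> and \<open>W\<close> constant equal to a number \<open>a < inf I(K)\<close>.

  For the lower bound, perturb a given point of \<open>G\<close> to a point \<open>\<nu>\<close> with positive entries; this is harmless
  since \<open>I\<close> is convex and finite at the uniform distribution. For such \<open>\<nu>\<close> the supremum
  defining \<open>I(\<nu>)\<close> is attained at some \<open>u\<close> (\<open>rate_attained\<close>), and the first-order condition at \<open>u\<close> says that
  \<open>\<nu>\<close> is invariant for an irreducible chain that depends on \<open>u\<close> alone. So \<open>\<nu>\<close> is the only measure
  for which \<open>u\<close> is optimal (\<open>maximiser_determines_measure\<close>). With \<open>W = V\<close>, the exponential bound therefore
  applies to the complement of any neighbourhood of \<open>\<nu>\<close>, while by the identity the total mass of the
  weight \<open>exp (t \<langle>V, L\<^sub>t\<rangle>)\<close> stays bounded below. Nearly all of that mass must sit where \<open>L\<^sub>t\<close> is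
  close to \<open>\<nu>\<close>, and there the weight is about \<open>exp (t I(\<nu>))\<close>, which bounds the probability below by
  about \<open>exp (- t I(\<nu>))\<close>. This is the usual change of measure, performed without constructing the
  tilted chain.
\<close>

section \<open>The matrix exponential near time zero\<close>

lemma mat_power_scaleR: "mat_power (h *\<^sub>R A) k = h ^ k *\<^sub>R mat_power A k"
  by (induction k)
    (simp_all add: vec_eq_iff matrix_matrix_mult_def sum_distrib_left mult_ac)

lemma mat_power_entry_bound:
  fixes A :: "real ^ 'n ^ 'n::finite"
  assumes "\<And>i j. \<bar>A $ i $ j\<bar> \<le> a"
  shows "\<bar>mat_power A k $ i $ j\<bar> \<le> (real CARD('n) * a) ^ k"
proof (induction k arbitrary: i j)
  case 0
  show ?case by (simp add: mat_def)
next
  case (Suc k)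
  have "\<bar>mat_power A (Suc k) $ i $ j\<bar> \<le> (\<Sum>l\<in>UNIV. \<bar>A $ i $ l\<bar> * \<bar>mat_power A k $ l $ j\<bar>)"
    by (simp add: matrix_matrix_mult_def abs_mult[symmetric] sum_abs)
  also have "\<dots> \<le> (\<Sum>l\<in>(UNIV::'n set). a * (real CARD('n) * a) ^ k)"
    by (intro sum_mono mult_mono assms Suc) (use assms[of i i] in auto)
  finally show ?case by (simp add: mult_ac)
qed

lemma abs_entry_le_sum:
  fixes A :: "real ^ 'n ^ 'n::finite"
  shows "\<bar>A $ i $ j\<bar> \<le> (\<Sum>i\<in>UNIV. \<Sum>j\<in>UNIV. \<bar>A $ i $ j\<bar>)"
proof -
  have "\<bar>A $ i $ j\<bar> \<le> (\<Sum>j\<in>UNIV. \<bar>A $ i $ j\<bar>)" by (rule member_le_sum) auto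
  also have "\<dots> \<le> (\<Sum>i\<in>UNIV. \<Sum>j\<in>UNIV. \<bar>A $ i $ j\<bar>)"
    by (rule member_le_sum) (auto intro: sum_nonneg)
  finally show ?thesis .
qed

lemma mat_exp_entry_sums:
  fixes A :: "real ^ 'n ^ 'n::finite"
  shows "(\<lambda>k. mat_power A k $ i $ j / fact k) sums (mat_exp A $ i $ j)"
proof -
  define a where "a = (\<Sum>i\<in>UNIV. \<Sum>j\<in>UNIV. \<bar>A $ i $ j\<bar>)"
  have a: "\<bar>A $ i $ j\<bar> \<le> a" for i j
    unfolding a_def by (rule abs_entry_le_sum)
  let ?b = "real CARD('n) * a"
  let ?f = "\<lambda>k. (1 / fact k) *\<^sub>R mat_power A k"
  have nrm: "norm B \<le> (\<Sum>i\<in>UNIV. \<Sum>j\<in>UNIV. \<bar>B $ i $ j\<bar>)" for B :: "real ^ 'n ^ 'n"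
  proof -
    have "norm B \<le> (\<Sum>i\<in>UNIV. norm (B $ i))"
      by (simp add: norm_vec_def L2_set_le_sum)
    also have "\<dots> \<le> (\<Sum>i\<in>UNIV. \<Sum>j\<in>UNIV. \<bar>B $ i $ j\<bar>)"
      by (intro sum_mono norm_le_l1_cart)
    finally show ?thesis .
  qed
  have "summable (\<lambda>k. real CARD('n) * (real CARD('n) * (inverse (fact k) * ?b ^ k)))"
    by (intro summable_mult summable_exp)
  then have "summable ?f"
  proof (rule summable_comparison_test[rotated], intro exI allI impI)
    fix k :: nat
    have "norm (?f k) \<le> (\<Sum>i\<in>UNIV. \<Sum>j\<in>UNIV. \<bar>?f k $ i $ j\<bar>)" by (rule nrm)
    also have "\<dots> \<le> (\<Sum>i\<in>(UNIV::'n set). \<Sum>j\<in>(UNIV::'n set). inverse (fact k) * ?b ^ k)"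
      by (intro sum_mono)
        (auto simp: abs_mult divide_inverse intro!: mult_left_mono mat_power_entry_bound[OF a])
    finally show "norm (?f k) \<le> real CARD('n) * (real CARD('n) * (inverse (fact k) * ?b ^ k))"
      by simp
  qed
  then have "?f sums mat_exp A" unfolding mat_exp_def by (rule summable_sums)
  then have "(\<lambda>k. ?f k $ i $ j) sums (mat_exp A $ i $ j)"
    by (intro bounded_linear.sums[OF bounded_linear_vec_nth]) 
  then show ?thesis by simp
qed

text \<open>
  All that the proof uses of the transition function is this expansion at time \<open>0\<close>, with an error
  that is quadratic in \<open>h\<close>, uniformly in the entries. The terms of order at least two carry a factor
  \<open>h\<^sup>k \<le> h\<^sup>2\<close>, and the remaining series converges.
\<close>

lemma mat_exp_first_order:
  fixes A :: "real ^ 'n ^ 'n::finite"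
  obtains C where "0 \<le> C"
    and "\<And>h i j. 0 \<le> h \<Longrightarrow> h \<le> 1 \<Longrightarrow>
           \<bar>mat_exp (h *\<^sub>R A) $ i $ j - (mat 1 $ i $ j + h * A $ i $ j)\<bar> \<le> C * h\<^sup>2"
proof
  define a where "a = (\<Sum>i\<in>UNIV. \<Sum>j\<in>UNIV. \<bar>A $ i $ j\<bar>)"
  have a: "\<bar>A $ i $ j\<bar> \<le> a" for i j
    unfolding a_def by (rule abs_entry_le_sum)
  have a0: "0 \<le> a" unfolding a_def by (intro sum_nonneg) auto
  define b where "b = real CARD('n) * a"
  have b0: "0 \<le> b" using a0 by (simp add: b_def)
  show "0 \<le> exp b" by simp
  fix h :: real and i j
  assume h: "0 \<le> h" "h \<le> 1"
  let ?f = "\<lambda>k. mat_power (h *\<^sub>R A) k $ i $ j / fact k"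
  have s: "?f sums (mat_exp (h *\<^sub>R A) $ i $ j)" by (rule mat_exp_entry_sums)
  have "(\<lambda>k. ?f (k + 2)) sums (mat_exp (h *\<^sub>R A) $ i $ j - (\<Sum>k<2. ?f k))"
    using s by (subst sums_iff_shift) simp
  moreover have "(\<Sum>k<2. ?f k) = mat 1 $ i $ j + h * A $ i $ j"
    by (simp add: numeral_2_eq_2 matrix_mul_rid)
  ultimately have tail: "(\<lambda>k. ?f (k + 2)) sums
      (mat_exp (h *\<^sub>R A) $ i $ j - (mat 1 $ i $ j + h * A $ i $ j))" by simp
  have e: "(\<lambda>k. b ^ k /\<^sub>R fact k) sums exp b" by (rule exp_converges)
  have term_bound: "norm (?f (k + 2)) \<le> h\<^sup>2 * (b ^ (k + 2) / fact (k + 2))" for k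
  proof -
    have "\<bar>mat_power (h *\<^sub>R A) (k + 2) $ i $ j\<bar> = h ^ (k + 2) * \<bar>mat_power A (k + 2) $ i $ j\<bar>"
      using h by (simp add: mat_power_scaleR abs_mult del: mat_power.simps)
    also have "\<dots> \<le> h\<^sup>2 * b ^ (k + 2)"
      using h mat_power_entry_bound[OF a, of "k + 2" i j]
      by (intro mult_mono power_decreasing) (auto simp: b_def)
    finally show ?thesis by (simp add: divide_right_mono del: mat_power.simps)
  qed
  have "(\<lambda>k. b ^ (k + 2) / fact (k + 2)) sums (exp b - (\<Sum>k<2. b ^ k / fact k))"
    using e by (subst sums_iff_shift) (simp add: divide_inverse mult.commute)
  then have "(\<lambda>k. b ^ (k + 2) / fact (k + 2)) sums (exp b - (1 + b))"
    by (simp add: numeral_2_eq_2)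
  then have se: "(\<lambda>k. h\<^sup>2 * (b ^ (k + 2) / fact (k + 2))) sums (h\<^sup>2 * (exp b - (1 + b)))"
    by (rule sums_mult)
  have "\<bar>mat_exp (h *\<^sub>R A) $ i $ j - (mat 1 $ i $ j + h * A $ i $ j)\<bar> \<le> h\<^sup>2 * (exp b - (1 + b))"
    using norm_suminf_le[OF term_bound sums_summable[OF se]] tail se by (simp add: sums_iff)
  also have "\<dots> \<le> exp b * h\<^sup>2"
    using b0 by (simp add: algebra_simps)
  finally show "\<bar>mat_exp (h *\<^sub>R A) $ i $ j - (mat 1 $ i $ j + h * A $ i $ j)\<bar> \<le> exp b * h\<^sup>2" .
qed

section \<open>Measurability and the Markov property\<close>

text \<open>
  Functions on the states vanish at the cemetery, so that a factor \<open>zero_ext u (X t \<omega>)\<close> also carries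
  the restriction to survival up to time \<open>t\<close>.
\<close>

definition zero_ext :: "real ^ 'n \<Rightarrow> 'n::finite option \<Rightarrow> real" where
  "zero_ext f x = (case x of None \<Rightarrow> 0 | Some j \<Rightarrow> f $ j)"

lemma zero_ext_simps [simp]: "zero_ext f None = 0" "zero_ext f (Some j) = f $ j"
  by (simp_all add: zero_ext_def)

lemma zero_ext_sum: "zero_ext f x = (\<Sum>j\<in>UNIV. f $ j * indicator {Some j} x)"
  by (cases x) (auto simp: indicator_def if_distrib sum.delta' cong: if_cong)

lemma zero_ext_axis: "zero_ext (axis j 1) x = indicator {Some j} x"
  by (cases x) (auto simp: axis_def indicator_def)

context killed_markov_chain
begin

lemma space_P [simp]: "space (P i) = space M"
  using sets_P by (rule sets_eq_imp_space_eq)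

text \<open>
  Joint measurability is given on nonnegative times only. Freezing negative times at \<open>0\<close> produces a
  process on all of \<open>borel\<close> to which Fubini's theorem applies directly.
\<close>

lemma X_measurable_max: "(\<lambda>(t, \<omega>). X (max 0 t) \<omega>) \<in> borel \<Otimes>\<^sub>M M \<rightarrow>\<^sub>M count_space UNIV"
proof -
  have "(\<lambda>(t :: real, \<omega>). (max 0 t, \<omega>)) \<in> borel \<Otimes>\<^sub>M M \<rightarrow>\<^sub>M restrict_space borel {0..} \<Otimes>\<^sub>M M"
    unfolding split_beta'
    by (intro measurable_Pair measurable_restrict_space2 borel_measurable_max) auto
  from measurable_compose[OF this measurable_X] show ?thesis
    by (simp add: split_beta')
qed

lemma X_measurable: "0 \<le> t \<Longrightarrow> X t \<in> M \<rightarrow>\<^sub>M count_space UNIV"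
  using measurable_compose[OF measurable_Pair1' X_measurable_max, of t] by simp

lemma X_measurable_P: "0 \<le> t \<Longrightarrow> X t \<in> P i \<rightarrow>\<^sub>M count_space UNIV"
  using X_measurable measurable_cong_sets[OF sets_P refl] by blast

lemma zero_ext_X_measurable [measurable]: "0 \<le> t \<Longrightarrow> (\<lambda>\<omega>. zero_ext f (X t \<omega>)) \<in> borel_measurable M"
  by (rule measurable_compose[OF X_measurable]) auto

lemma space_natural_filtration [simp]: "space (natural_filtration M X s) = space M"
  unfolding natural_filtration_def by (rule space_measure_of) auto

lemma sets_natural_filtration:
  "sets (natural_filtration M X s) =
     sigma_sets (space M) {X r -` A \<inter> space M | r A. 0 \<le> r \<and> r \<le> s}"
  unfolding natural_filtration_def by (rule sets_measure_of) auto

lemma X_adapted: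
  assumes "0 \<le> r" "r \<le> s"
  shows "X r \<in> natural_filtration M X s \<rightarrow>\<^sub>M count_space UNIV"
proof (rule measurableI)
  fix A :: "'n option set"
  show "X r -` A \<inter> space (natural_filtration M X s) \<in> sets (natural_filtration M X s)"
    using assms by (auto simp: sets_natural_filtration)
qed simp

lemma subalgebra_natural_filtration: "subalgebra (P i) (natural_filtration M X s)"
proof -
  have "{X r -` A \<inter> space M | r A. 0 \<le> r \<and> r \<le> s} \<subseteq> sets M"
    using measurable_sets[OF X_measurable] by fastforce
  then show ?thesis
    unfolding subalgebra_def sets_natural_filtration sets_P
    by (simp add: sets.sigma_sets_subset)
qed

lemma transition_prob:
  assumes "0 \<le> t"
  shows "measure (P i) {\<omega> \<in> space M. X t \<omega> = Some j} = mat_exp (t *\<^sub>R Q) $ i $ j"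
proof -
  have "{\<omega> \<in> space M. X t \<omega> = Some j} = {\<omega> \<in> space M. X t \<omega> = Some j \<and> ereal t < \<zeta> \<omega>}"
    using alive_iff[OF assms] by auto
  then show ?thesis using transition[OF assms, of i j] by simp
qed

text \<open>
  The conditional expectation in the Markov property is integrated out once and for all: against a
  bounded functional of the past, a function of the state at time \<open>s + h\<close> may be replaced by its image
  under the semigroup at time \<open>s\<close>.
\<close>

lemma markov_step:
  assumes s: "0 \<le> s" and h: "0 \<le> h"
    and Y: "Y \<in> borel_measurable (natural_filtration M X s)"
    and B: "\<And>\<omega>. \<omega> \<in> space M \<Longrightarrow> \<bar>Y \<omega>\<bar> \<le> B"
  shows "(\<integral>\<omega>. Y \<omega> * zero_ext g (X (s + h) \<omega>) \<partial>P i) =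
         (\<integral>\<omega>. Y \<omega> * zero_ext (mat_exp (h *\<^sub>R Q) *v g) (X s \<omega>) \<partial>P i)"
proof -
  let ?F = "natural_filtration M X s"
  interpret prob_space "P i" by (rule prob_space_P)
  interpret finite_measure_subalgebra "P i" ?F
    by unfold_locales (rule subalgebra_natural_filtration)
  have YP: "Y \<in> borel_measurable (P i)"
    using measurable_from_subalg[OF subalgebra_natural_filtration Y] .
  have ind: "(\<lambda>\<omega>. indicator {Some k} (X r \<omega>) :: real) \<in> borel_measurable (P i)" if "0 \<le> r" for r k
    by (rule measurable_compose[OF X_measurable_P[OF that]]) auto
  have int: "integrable (P i) (\<lambda>\<omega>. Y \<omega> * indicator {Some k} (X r \<omega>))" if "0 \<le> r" for r k
  proof (rule integrable_const_bound)
    show "AE \<omega> in P i. norm (Y \<omega> * indicator {Some k} (X r \<omega>)) \<le> B"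
      using B by (intro AE_I2) (fastforce simp: indicator_def intro: order_trans[OF abs_ge_zero])
    show "(\<lambda>\<omega>. Y \<omega> * indicator {Some k} (X r \<omega>)) \<in> borel_measurable (P i)"
      using that by (intro borel_measurable_times YP ind)
  qed
  have step: "(\<integral>\<omega>. Y \<omega> * indicator {Some k} (X (s + h) \<omega>) \<partial>P i) =
      (\<integral>\<omega>. Y \<omega> * (\<Sum>j\<in>UNIV. mat_exp (h *\<^sub>R Q) $ j $ k * indicator {Some j} (X s \<omega>)) \<partial>P i)" for k
  proof -
    let ?g = "indicator {\<omega>'. X (s + h) \<omega>' = Some k} :: 'a \<Rightarrow> real"
    have g: "?g = (\<lambda>\<omega>. indicator {Some k} (X (s + h) \<omega>))"
      by (auto simp: indicator_def)
    have "(\<integral>\<omega>. Y \<omega> * ?g \<omega> \<partial>P i) = (\<integral>\<omega>. Y \<omega> * real_cond_exp (P i) ?F ?g \<omega> \<partial>P i)"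
      unfolding g using s h by (intro real_cond_exp_intg(2)[symmetric] int Y ind) auto
    also have "\<dots> = (\<integral>\<omega>. Y \<omega> * (\<Sum>j\<in>UNIV. mat_exp (h *\<^sub>R Q) $ j $ k * indicator {Some j} (X s \<omega>)) \<partial>P i)"
    proof (rule integral_cong_AE)
      have "AE \<omega> in P i. real_cond_exp (P i) ?F ?g \<omega> = (case X s \<omega> of None \<Rightarrow> 0
           | Some j \<Rightarrow> measure (P j) {\<omega>' \<in> space M. X h \<omega>' = Some k})"
        by (rule markov[OF s h])
      then show "AE \<omega> in P i. Y \<omega> * real_cond_exp (P i) ?F ?g \<omega> =
          Y \<omega> * (\<Sum>j\<in>UNIV. mat_exp (h *\<^sub>R Q) $ j $ k * indicator {Some j} (X s \<omega>))"
      proof eventually_elim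
        case (elim \<omega>)
        then show ?case
          by (cases "X s \<omega>")
            (auto simp: transition_prob[OF h] indicator_def if_distrib sum.delta' cong: if_cong)
      qed
      show "(\<lambda>\<omega>. Y \<omega> * real_cond_exp (P i) ?F ?g \<omega>) \<in> borel_measurable (P i)"
        by (intro borel_measurable_times YP borel_measurable_cond_exp2)
      show "(\<lambda>\<omega>. Y \<omega> * (\<Sum>j\<in>UNIV. mat_exp (h *\<^sub>R Q) $ j $ k * indicator {Some j} (X s \<omega>)))
          \<in> borel_measurable (P i)"
        by (intro borel_measurable_times borel_measurable_sum borel_measurable_const YP ind s)
    qed
    finally show ?thesis by (simp add: g)
  qed
  have "(\<integral>\<omega>. Y \<omega> * zero_ext g (X (s + h) \<omega>) \<partial>P i) =
      (\<integral>\<omega>. (\<Sum>k\<in>UNIV. g $ k * (Y \<omega> * indicator {Some k} (X (s + h) \<omega>))) \<partial>P i)"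
    unfolding zero_ext_sum sum_distrib_left by (simp only: mult_ac)
  also have "\<dots> = (\<Sum>k\<in>UNIV. g $ k * (\<integral>\<omega>. Y \<omega> * indicator {Some k} (X (s + h) \<omega>) \<partial>P i))"
    using s h by (subst Bochner_Integration.integral_sum) (auto intro!: int)
  also have "\<dots> = (\<Sum>k\<in>UNIV. g $ k * (\<Sum>j\<in>UNIV. mat_exp (h *\<^sub>R Q) $ j $ k *
      (\<integral>\<omega>. Y \<omega> * indicator {Some j} (X s \<omega>) \<partial>P i)))"
  proof -
    have "(\<integral>\<omega>. Y \<omega> * (\<Sum>j\<in>UNIV. mat_exp (h *\<^sub>R Q) $ j $ k * indicator {Some j} (X s \<omega>)) \<partial>P i) =
      (\<integral>\<omega>. (\<Sum>j\<in>UNIV. mat_exp (h *\<^sub>R Q) $ j $ k * (Y \<omega> * indicator {Some j} (X s \<omega>))) \<partial>P i)" for k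
      unfolding sum_distrib_left by (simp only: mult_ac)
    also have "\<dots> k = (\<Sum>j\<in>UNIV. mat_exp (h *\<^sub>R Q) $ j $ k *
      (\<integral>\<omega>. Y \<omega> * indicator {Some j} (X s \<omega>) \<partial>P i))" for k
      using s by (subst Bochner_Integration.integral_sum) (auto intro!: int)
    finally show ?thesis by (simp add: step)
  qed
  also have "\<dots> = (\<Sum>j\<in>UNIV. (mat_exp (h *\<^sub>R Q) *v g) $ j *
      (\<integral>\<omega>. Y \<omega> * indicator {Some j} (X s \<omega>) \<partial>P i))"
    unfolding matrix_vector_mult_def vec_lambda_beta sum_distrib_left sum_distrib_right
    by (subst sum.swap) (simp only: mult_ac)
  also have "\<dots> = (\<integral>\<omega>. (\<Sum>j\<in>UNIV. (mat_exp (h *\<^sub>R Q) *v g) $ j *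
      (Y \<omega> * indicator {Some j} (X s \<omega>))) \<partial>P i)"
    using s by (subst Bochner_Integration.integral_sum) (auto intro!: int)
  also have "\<dots> = (\<integral>\<omega>. Y \<omega> * zero_ext (mat_exp (h *\<^sub>R Q) *v g) (X s \<omega>) \<partial>P i)"
    unfolding zero_ext_sum sum_distrib_left by (simp only: mult_ac)
  finally show ?thesis .
qed

end

section \<open>Short-time estimates\<close>

lemma set_integrable_const_interval: "set_integrable lborel {a..b :: real} (\<lambda>r. c :: real)"
  unfolding set_integrable_def
  by (intro integrable_scaleR_left integrable_real_indicator emeasure_bounded_finite
      bounded_closed_interval) auto

lemma abs_zero_ext_le_norm: "\<bar>zero_ext f x\<bar> \<le> norm f"
  by (cases x) (auto simp: component_le_norm_cart)

lemma abs_exp_diff_le: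
  fixes x y m :: real
  assumes "x \<le> m" "y \<le> m"
  shows "\<bar>exp x - exp y\<bar> \<le> exp m * \<bar>x - y\<bar>"
proof -
  have *: "\<bar>exp x - exp y\<bar> \<le> exp m * \<bar>x - y\<bar>" if "x \<le> y" "y \<le> m" for x y :: real
  proof -
    have "exp y - exp x = exp y * (1 - exp (x - y))"
      by (simp add: algebra_simps exp_diff)
    also have "\<dots> \<le> exp m * (y - x)"
    proof (intro mult_mono)
      show "1 - exp (x - y) \<le> y - x"
        using exp_ge_add_one_self[of "x - y"] by linarith
    qed (use that in auto)
    finally show ?thesis using that by simp
  qed
  show ?thesis
    using *[of x y] *[of y x] assms by (cases "x \<le> y") (auto simp: abs_minus_commute)
qed

lemma abs_exp_mult_one_minus_le:
  fixes x :: real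
  shows "\<bar>exp x * (1 - x) - 1\<bar> \<le> exp \<bar>x\<bar> * x\<^sup>2"
proof -
  have "exp x * (1 - x) - 1 \<le> 0"
  proof -
    have "exp x * (1 - x) \<le> exp x * exp (- x)"
      using exp_ge_add_one_self[of "- x"] by (intro mult_left_mono) auto
    then show ?thesis by (simp add: exp_minus)
  qed
  moreover have "1 - exp x * (1 - x) \<le> exp \<bar>x\<bar> * x\<^sup>2"
  proof -
    have "1 - exp x * (1 - x) = exp x * (exp (- x) - (1 - x))"
      by (simp add: algebra_simps exp_minus)
    also have "exp x * (exp (- x) - (1 - x)) = x * exp x - (exp x - 1)"
      by (simp add: algebra_simps exp_minus)
    also have "\<dots> \<le> x * exp x - x"
      using exp_ge_add_one_self[of x] by linarith
    also have "\<dots> = x * (exp x - exp 0)" by (simp add: right_diff_distrib)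
    also have "\<dots> \<le> \<bar>x\<bar> * \<bar>exp x - exp 0\<bar>"
      unfolding abs_mult[symmetric] by (rule abs_ge_self)
    also have "\<dots> \<le> \<bar>x\<bar> * (exp \<bar>x\<bar> * \<bar>x - 0\<bar>)"
      by (intro mult_left_mono abs_exp_diff_le) auto
    also have "\<dots> = exp \<bar>x\<bar> * x\<^sup>2" by (simp add: power2_eq_square)
    finally show ?thesis .
  qed
  ultimately show ?thesis by simp
qed

text \<open>
  The potential for which \<open>u\<close> is harmonic: \<open>(Q + V) u = 0\<close> for \<open>V = potential Q u\<close>.
\<close>

definition potential :: "real ^ 'n ^ 'n \<Rightarrow> real ^ 'n \<Rightarrow> real ^ 'n::finite" where
  "potential Q u = (\<chi> j. - (Q *v u) $ j / u $ j)"

text \<open>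
  One step of the discretised Feynman-Kac semigroup fixes \<open>u\<close> to first order, because
  \<open>exp(h Q) u = u + h Q u + O(h\<^sup>2) = (1 - h V) u + O(h\<^sup>2)\<close> and \<open>exp(h V) (1 - h V) = 1 + O(h\<^sup>2)\<close>. The error
  is stated relative to \<open>u\<close>, so that it can be iterated with a positive operator.
\<close>

lemma twisted_step_near_identity:
  fixes Q :: "real ^ 'n ^ 'n::finite"
  assumes u: "\<And>j. 0 < u $ j"
  obtains C where "0 \<le> C"
    and "\<And>h j. 0 \<le> h \<Longrightarrow> h \<le> 1 \<Longrightarrow>
      \<bar>exp (h * (- (Q *v u) $ j / u $ j)) * (mat_exp (h *\<^sub>R Q) *v u) $ j - u $ j\<bar> \<le> C * h\<^sup>2 * u $ j"
proof -
  obtain C0 where C0: "0 \<le> C0" and first: "\<And>h i j. 0 \<le> h \<Longrightarrow> h \<le> 1 \<Longrightarrow>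
      \<bar>mat_exp (h *\<^sub>R Q) $ i $ j - (mat 1 $ i $ j + h * Q $ i $ j)\<bar> \<le> C0 * h\<^sup>2"
    by (rule mat_exp_first_order[of Q]) (rule that)
  define v where "v j = - (Q *v u) $ j / u $ j" for j
  define S where "S = (\<Sum>j\<in>UNIV. u $ j)"
  define c where "c j = exp \<bar>v j\<bar> * (v j)\<^sup>2 + exp \<bar>v j\<bar> * (C0 * S) / u $ j" for j
  have S: "0 \<le> S" unfolding S_def using u by (intro sum_nonneg) (auto intro: less_imp_le)
  have c: "0 \<le> c j" for j unfolding c_def using C0 S u[of j] by auto
  show thesis
  proof
    show "0 \<le> (\<Sum>j\<in>UNIV. c j)" by (intro sum_nonneg c)
    fix h :: real and j
    assume h: "0 \<le> h" "h \<le> 1"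
    let ?p = "(mat_exp (h *\<^sub>R Q) *v u) $ j" and ?x = "h * v j"
    have vu: "(Q *v u) $ j = - v j * u $ j" using u[of j] by (simp add: v_def)
    have "\<bar>?p - u $ j * (1 - ?x)\<bar> \<le> C0 * h\<^sup>2 * S"
    proof -
      have "u $ j * (1 - ?x) = (\<Sum>l\<in>UNIV. (mat 1 $ j $ l + h * Q $ j $ l) * u $ l)"
      proof -
        have "(\<Sum>l\<in>UNIV. (mat 1 $ j $ l + h * Q $ j $ l) * u $ l) =
            (mat 1 *v u) $ j + h * (Q *v u) $ j"
          by (simp add: matrix_vector_mult_def sum.distrib sum_distrib_left algebra_simps)
        also have "\<dots> = u $ j * (1 - ?x)" by (simp add: vu algebra_simps)
        finally show ?thesis ..
      qed
      then have "?p - u $ j * (1 - ?x) =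
          (\<Sum>l\<in>UNIV. (mat_exp (h *\<^sub>R Q) $ j $ l - (mat 1 $ j $ l + h * Q $ j $ l)) * u $ l)"
        by (simp add: matrix_vector_mult_def sum_subtractf[symmetric] left_diff_distrib)
      also have "\<bar>\<dots>\<bar> \<le> (\<Sum>l\<in>UNIV. C0 * h\<^sup>2 * u $ l)"
      proof (rule order_trans[OF sum_abs sum_mono])
        fix l
        show "\<bar>(mat_exp (h *\<^sub>R Q) $ j $ l - (mat 1 $ j $ l + h * Q $ j $ l)) * u $ l\<bar> \<le> C0 * h\<^sup>2 * u $ l"
          unfolding abs_mult abs_of_pos[OF u] by (intro mult_right_mono first h less_imp_le[OF u])
      qed
      finally show ?thesis by (simp add: S_def sum_distrib_left)
    qed
    moreover have hv: "\<bar>?x\<bar> \<le> \<bar>v j\<bar>"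
      unfolding abs_mult using h by (simp add: mult_left_le_one_le)
    then have "exp ?x \<le> exp \<bar>v j\<bar>" by simp
    ultimately have 1: "\<bar>exp ?x * (?p - u $ j * (1 - ?x))\<bar> \<le> exp \<bar>v j\<bar> * (C0 * h\<^sup>2 * S)"
      unfolding abs_mult abs_exp_cancel by (intro mult_mono) auto
    have "\<bar>exp ?x * (1 - ?x) - 1\<bar> \<le> exp \<bar>?x\<bar> * ?x\<^sup>2" by (rule abs_exp_mult_one_minus_le)
    also have "\<dots> \<le> exp \<bar>v j\<bar> * ?x\<^sup>2"
      using hv by (intro mult_right_mono) auto
    finally have 2: "\<bar>u $ j * (exp ?x * (1 - ?x) - 1)\<bar> \<le> u $ j * (exp \<bar>v j\<bar> * (h\<^sup>2 * (v j)\<^sup>2))"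
      unfolding abs_mult abs_of_pos[OF u] power_mult_distrib
      by (intro mult_left_mono less_imp_le[OF u])
    have "\<bar>exp ?x * ?p - u $ j\<bar> =
        \<bar>exp ?x * (?p - u $ j * (1 - ?x)) + u $ j * (exp ?x * (1 - ?x) - 1)\<bar>"
      by (simp add: algebra_simps)
    also have "\<dots> \<le> exp \<bar>v j\<bar> * (C0 * h\<^sup>2 * S) + u $ j * (exp \<bar>v j\<bar> * (h\<^sup>2 * (v j)\<^sup>2))"
      using 1 2 by linarith
    also have "\<dots> = c j * h\<^sup>2 * u $ j"
      using u[of j] by (simp add: c_def distrib_right distrib_left mult_ac)
    also have "\<dots> \<le> (\<Sum>j\<in>UNIV. c j) * h\<^sup>2 * u $ j"
      using u[of j] c by (intro mult_right_mono member_le_sum) auto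
    finally show "\<bar>exp (h * (- (Q *v u) $ j / u $ j)) * ?p - u $ j\<bar> \<le> (\<Sum>j\<in>UNIV. c j) * h\<^sup>2 * u $ j"
      by (simp add: v_def)
  qed
qed

context killed_markov_chain
begin

definition path_integral :: "real ^ 'n \<Rightarrow> real \<Rightarrow> 'a \<Rightarrow> real" where
  "path_integral f t \<omega> = (LINT s:{0..t}|lborel. zero_ext f (X s \<omega>))"

lemma dead_stays_dead:
  assumes "0 \<le> r" "r \<le> s" "\<omega> \<in> space M" "X r \<omega> = None"
  shows "X s \<omega> = None"
proof (rule ccontr)
  assume "X s \<omega> \<noteq> None"
  then have "ereal s < \<zeta> \<omega>" using alive_iff[of s \<omega>] assms by auto
  then have "ereal r < \<zeta> \<omega>" using assms(2) by (meson ereal_less_eq(3) order_le_less_trans)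
  then show False using alive_iff[of r \<omega>] assms by auto
qed

lemma state_indicator_measurable: "0 \<le> t \<Longrightarrow> (\<lambda>\<omega>. indicator {Some j} (X t \<omega>) :: real) \<in> borel_measurable M"
  by (rule measurable_compose[OF X_measurable]) auto

lemma change_event_measurable:
  assumes "0 \<le> r" "0 \<le> s"
  shows "{\<omega> \<in> space M. X r \<omega> \<noteq> X s \<omega>} \<in> sets M"
  using measurable_sets[OF measurable_Pair_compose_split[OF _ X_measurable[OF assms(1)]
      X_measurable[OF assms(2)], of "\<lambda>a b. a \<noteq> b" "count_space UNIV"], of "{True}"]
  by (simp add: vimage_def Int_def conj_commute)

lemma integrable_bounded_P:
  assumes "f \<in> borel_measurable M" "\<And>\<omega>. \<omega> \<in> space M \<Longrightarrow> \<bar>f \<omega>\<bar> \<le> (B :: real)"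
  shows "integrable (P i) f"
proof -
  interpret prob_space "P i" by (rule prob_space_P)
  have "f \<in> borel_measurable (P i)" using assms(1) measurable_cong_sets[OF sets_P refl] by blast
  then show ?thesis using assms(2) by (intro integrable_const_bound[of _ B] AE_I2) auto
qed

text \<open>
  This replaces regularity of the paths. A path that is in state \<open>j\<close> at time \<open>s\<close> is there again at time
  \<open>s + h\<close> with probability \<open>exp(h Q)\<^sub>j\<^sub>j = 1 - O(h)\<close>, and a dead path stays dead.
\<close>

lemma jump_probability_linear:
  obtains C where "0 \<le> C"
    and "\<And>i s h. 0 \<le> s \<Longrightarrow> 0 \<le> h \<Longrightarrow> h \<le> 1 \<Longrightarrow>
           measure (P i) {\<omega> \<in> space M. X (s + h) \<omega> \<noteq> X s \<omega>} \<le> C * h"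
proof -
  obtain C0 where C0: "0 \<le> C0" and first: "\<And>h i j. 0 \<le> h \<Longrightarrow> h \<le> 1 \<Longrightarrow>
      \<bar>mat_exp (h *\<^sub>R Q) $ i $ j - (mat 1 $ i $ j + h * Q $ i $ j)\<bar> \<le> C0 * h\<^sup>2"
    by (rule mat_exp_first_order[of Q]) (rule that)
  define C where "C = C0 + (\<Sum>j\<in>UNIV. \<bar>Q $ j $ j\<bar>)"
  show thesis
  proof
    show "0 \<le> C" unfolding C_def by (intro add_nonneg_nonneg C0 sum_nonneg) auto
    fix i and s h :: real
    assume s: "0 \<le> s" and h: "0 \<le> h" "h \<le> 1"
    interpret prob_space "P i" by (rule prob_space_P)
    have sh: "0 \<le> s + h" using s h by simp
    let ?I = "\<lambda>j t \<omega>. indicator {Some j} (X t \<omega>) :: real"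
    define p where "p j = mat_exp (h *\<^sub>R Q) $ j $ j" for j
    have p: "1 - p j \<le> C * h" for j
    proof -
      have "\<bar>p j - (1 + h * Q $ j $ j)\<bar> \<le> C0 * h\<^sup>2"
        using first[OF h, of j j] by (simp add: p_def mat_def)
      moreover have "C0 * h\<^sup>2 \<le> C0 * h"
        using h C0 by (intro mult_left_mono) (auto simp: power2_eq_square mult_left_le_one_le)
      moreover have "- (h * Q $ j $ j) \<le> h * (\<Sum>j\<in>UNIV. \<bar>Q $ j $ j\<bar>)"
      proof -
        have "\<bar>Q $ j $ j\<bar> \<le> (\<Sum>j\<in>UNIV. \<bar>Q $ j $ j\<bar>)" by (rule member_le_sum) auto
        then have "- (Q $ j $ j) \<le> (\<Sum>j\<in>UNIV. \<bar>Q $ j $ j\<bar>)" by linarith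
        from mult_left_mono[OF this h(1)] show ?thesis by simp
      qed
      ultimately show ?thesis by (simp add: C_def algebra_simps)
    qed
    have int: "integrable (P i) (?I j s)" for j
      by (rule integrable_bounded_P[where B=1, OF state_indicator_measurable[OF s]])
        (simp add: indicator_def)
    have int2: "integrable (P i) (\<lambda>\<omega>. ?I j s \<omega> * ?I j (s + h) \<omega>)" for j
      by (rule integrable_bounded_P[where B=1, OF borel_measurable_times[OF
            state_indicator_measurable[OF s] state_indicator_measurable[OF sh]]])
        (simp add: indicator_def)
    have stay: "(\<integral>\<omega>. ?I j s \<omega> * ?I j (s + h) \<omega> \<partial>P i) = p j * (\<integral>\<omega>. ?I j s \<omega> \<partial>P i)" for j
    proof -
      have "(\<integral>\<omega>. ?I j s \<omega> * zero_ext (axis j 1) (X (s + h) \<omega>) \<partial>P i) =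
          (\<integral>\<omega>. ?I j s \<omega> * zero_ext (mat_exp (h *\<^sub>R Q) *v axis j 1) (X s \<omega>) \<partial>P i)"
        by (rule markov_step[OF s h(1), where B=1])
          (auto intro: measurable_compose[OF X_adapted] s simp: indicator_def)
      also have "\<dots> = (\<integral>\<omega>. p j * ?I j s \<omega> \<partial>P i)"
        by (rule Bochner_Integration.integral_cong)
          (auto simp: indicator_def matrix_vector_mult_basis column_def p_def)
      finally show ?thesis by (simp add: zero_ext_axis)
    qed
    have ev: "{\<omega> \<in> space M. X (s + h) \<omega> \<noteq> X s \<omega>} \<in> sets (P i)"
      unfolding sets_P by (rule change_event_measurable[OF sh s])
    have "measure (P i) {\<omega> \<in> space M. X (s + h) \<omega> \<noteq> X s \<omega>} =
        (\<integral>\<omega>. indicator {\<omega> \<in> space M. X (s + h) \<omega> \<noteq> X s \<omega>} \<omega> \<partial>P i)"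
      using sets.sets_into_space[OF ev] by (simp add: Int_absorb2)
    also have "\<dots> = (\<integral>\<omega>. (\<Sum>j\<in>UNIV. ?I j s \<omega> - ?I j s \<omega> * ?I j (s + h) \<omega>) \<partial>P i)"
    proof (rule Bochner_Integration.integral_cong[OF refl])
      fix \<omega> assume \<omega>: "\<omega> \<in> space (P i)"
      show "indicator {\<omega> \<in> space M. X (s + h) \<omega> \<noteq> X s \<omega>} \<omega> =
          (\<Sum>j\<in>UNIV. ?I j s \<omega> - ?I j s \<omega> * ?I j (s + h) \<omega>)"
      proof (cases "X s \<omega>")
        case None
        then have "X (s + h) \<omega> = None" using dead_stays_dead[of s "s + h" \<omega>] s h \<omega> by auto
        with None show ?thesis by (simp add: indicator_def)
      next
        case (Some l)
        have "(\<Sum>j\<in>UNIV. ?I j s \<omega> - ?I j s \<omega> * ?I j (s + h) \<omega>) =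
            (\<Sum>j\<in>UNIV. if j = l then 1 - ?I l (s + h) \<omega> else 0)"
          by (rule sum.cong) (auto simp: Some indicator_def)
        then show ?thesis using \<omega> by (auto simp: Some indicator_def)
      qed
    qed
    also have "\<dots> = (\<Sum>j\<in>UNIV. (1 - p j) * (\<integral>\<omega>. ?I j s \<omega> \<partial>P i))"
      using int int2 by (subst Bochner_Integration.integral_sum)
        (simp_all add: stay left_diff_distrib)
    also have "\<dots> \<le> (\<Sum>j\<in>UNIV. C * h * (\<integral>\<omega>. ?I j s \<omega> \<partial>P i))"
      by (intro sum_mono mult_right_mono p integral_nonneg) auto
    also have "\<dots> = C * h * (\<integral>\<omega>. (\<Sum>j\<in>UNIV. ?I j s \<omega>) \<partial>P i)"
      using int by (subst Bochner_Integration.integral_sum) (auto simp: sum_distrib_left)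
    also have "\<dots> \<le> C * h * (\<integral>\<omega>. 1 \<partial>P i)"
    proof (intro mult_left_mono integral_mono)
      show "integrable (P i) (\<lambda>\<omega>. \<Sum>j\<in>UNIV. ?I j s \<omega>)" using int by auto
      show "(\<Sum>j\<in>UNIV. ?I j s \<omega>) \<le> 1" for \<omega>
        using zero_ext_sum[of "\<chi> j. 1" "X s \<omega>"] by (cases "X s \<omega>") auto
    qed (use \<open>0 \<le> C\<close> h in auto)
    finally show "measure (P i) {\<omega> \<in> space M. X (s + h) \<omega> \<noteq> X s \<omega>} \<le> C * h"
      using prob_space by simp
  qed
qed

lemma set_integrable_path:
  assumes "0 \<le> a" "\<omega> \<in> space M"
  shows "set_integrable lborel {a..b} (\<lambda>r. zero_ext f (X r \<omega>))"
proof -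
  have "(\<lambda>r. X (max 0 r) \<omega>) \<in> borel \<rightarrow>\<^sub>M count_space UNIV"
    using measurable_compose[OF measurable_Pair2'[OF assms(2)] X_measurable_max] by simp
  then have m: "(\<lambda>r. zero_ext f (X (max 0 r) \<omega>)) \<in> borel_measurable borel"
    by (rule measurable_compose) auto
  have "integrable lborel (\<lambda>r. indicator {a..b} r *\<^sub>R zero_ext f (X (max 0 r) \<omega>))"
  proof (rule Bochner_Integration.integrable_bound)
    show "integrable lborel (\<lambda>r. indicator {a..b} r * norm f)"
      by (intro integrable_mult_left integrable_real_indicator emeasure_bounded_finite bounded_closed_interval) auto
    show "AE r in lborel. norm (indicator {a..b} r *\<^sub>R zero_ext f (X (max 0 r) \<omega>))
        \<le> norm (indicator {a..b} r * norm f)"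
      by (auto simp: indicator_def abs_zero_ext_le_norm)
    show "(\<lambda>r. indicator {a..b} r *\<^sub>R zero_ext f (X (max 0 r) \<omega>)) \<in> borel_measurable lborel"
      using m by auto
  qed
  also have "(\<lambda>r. indicator {a..b} r *\<^sub>R zero_ext f (X (max 0 r) \<omega>)) =
      (\<lambda>r. indicator {a..b} r *\<^sub>R zero_ext f (X r \<omega>))"
    using assms(1) by (auto simp: fun_eq_iff indicator_def max_def)
  finally show ?thesis unfolding set_integrable_def .
qed

lemma zero_ext_X_measurable_pair:
  "(\<lambda>(\<omega>, r). zero_ext f (X (max 0 r) \<omega>)) \<in> borel_measurable (M \<Otimes>\<^sub>M lborel)"
proof -
  have "(\<lambda>(\<omega>, r :: real). (r, \<omega>)) \<in> M \<Otimes>\<^sub>M lborel \<rightarrow>\<^sub>M borel \<Otimes>\<^sub>M M"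
    unfolding split_beta' by (intro measurable_Pair) auto
  from measurable_compose[OF this X_measurable_max]
  have "(\<lambda>(\<omega>, r). X (max 0 r) \<omega>) \<in> M \<Otimes>\<^sub>M lborel \<rightarrow>\<^sub>M count_space UNIV"
    by (simp add: split_beta')
  from measurable_compose[OF this, of "zero_ext f" borel] show ?thesis
    by (simp add: split_beta')
qed

lemma path_integral_measurable:
  assumes "0 \<le> a"
  shows "(\<lambda>\<omega>. LINT r:{a..b}|lborel. zero_ext f (X r \<omega>)) \<in> borel_measurable M"
proof -
  have "(\<lambda>(\<omega>, r). indicator {a..b} r *\<^sub>R zero_ext f (X (max 0 r) \<omega>)) \<in> borel_measurable (M \<Otimes>\<^sub>M lborel)"
    using zero_ext_X_measurable_pair[of f] unfolding split_beta'
    by (intro borel_measurable_scaleR measurable_compose[OF measurable_snd]) auto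
  then have "(\<lambda>\<omega>. \<integral>r. indicator {a..b} r *\<^sub>R zero_ext f (X (max 0 r) \<omega>) \<partial>lborel) \<in> borel_measurable M"
    by (rule lborel.borel_measurable_lebesgue_integral)
  also have "(\<lambda>\<omega>. \<integral>r. indicator {a..b} r *\<^sub>R zero_ext f (X (max 0 r) \<omega>) \<partial>lborel) =
      (\<lambda>\<omega>. LINT r:{a..b}|lborel. zero_ext f (X r \<omega>))"
    unfolding set_lebesgue_integral_def using assms
    by (intro ext Bochner_Integration.integral_cong) (auto simp: indicator_def max_def)
  finally show ?thesis .
qed

lemma path_integral_bound:
  assumes "0 \<le> t" "\<omega> \<in> space M"
  shows "\<bar>path_integral f t \<omega>\<bar> \<le> t * norm f"
proof -
  have "norm (path_integral f t \<omega>) \<le> (LINT r:{0..t}|lborel. norm (zero_ext f (X r \<omega>)))"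
    unfolding path_integral_def by (rule set_integral_norm_bound[OF set_integrable_path]) (use assms in auto)
  also have "\<dots> \<le> (LINT r:{0..t}|lborel. norm f)"
  proof (rule set_integral_mono)
    show "set_integrable lborel {0..t} (\<lambda>r. norm (zero_ext f (X r \<omega>)))"
      using set_integrable_path[of 0 \<omega> t f] assms by (intro set_integrable_norm) auto
    show "set_integrable lborel {0..t} (\<lambda>r. norm f)"
      by (rule set_integrable_const_interval)
  qed (simp add: abs_zero_ext_le_norm)
  also have "\<dots> = t * norm f"
    using assms by (simp add: set_lebesgue_integral_def)
  finally show ?thesis by simp
qed

section \<open>The Feynman-Kac identity\<close>

text \<open>
  The integrand is bounded and vanishes unless the state differs from the one at time \<open>s\<close>, which has
  probability \<open>O(h)\<close>; integrating over a time interval of length \<open>h\<close> gives the second factor \<open>h\<close>.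
\<close>

lemma short_time_fluctuation:
  obtains C where "0 \<le> C"
    and "\<And>i s h. 0 \<le> s \<Longrightarrow> 0 \<le> h \<Longrightarrow> h \<le> 1 \<Longrightarrow>
      (\<integral>\<omega>. \<bar>LINT r:{s..s+h}|lborel. zero_ext f (X r \<omega>) - zero_ext f (X s \<omega>)\<bar> \<partial>P i) \<le> C * h\<^sup>2"
proof -
  obtain C0 where C0: "0 \<le> C0" and jump: "\<And>i s h. 0 \<le> s \<Longrightarrow> 0 \<le> h \<Longrightarrow> h \<le> 1 \<Longrightarrow>
           measure (P i) {\<omega> \<in> space M. X (s + h) \<omega> \<noteq> X s \<omega>} \<le> C0 * h"
    by (rule jump_probability_linear) (rule that)
  define C where "C = 2 * norm f * C0"
  show thesis
  proof
    show "0 \<le> C" using C0 by (simp add: C_def)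
    fix i and s h :: real
    assume s: "0 \<le> s" and h: "0 \<le> h" "h \<le> 1"
    interpret prob_space "P i" by (rule prob_space_P)
    interpret pair_sigma_finite lborel "P i" ..
    define F where "F r \<omega> = indicator {s..s+h} r *\<^sub>R (zero_ext f (X (max 0 r) \<omega>) - zero_ext f (X s \<omega>))"
      for r \<omega>
    have F_eq: "F r \<omega> = indicator {s..s+h} r *\<^sub>R (zero_ext f (X r \<omega>) - zero_ext f (X s \<omega>))" for r \<omega>
      using s by (auto simp: F_def indicator_def max_def)
    have F_int: "integrable lborel (\<lambda>r. F r \<omega>)" if "\<omega> \<in> space M" for \<omega>
    proof -
      have "set_integrable lborel {s..s+h} (\<lambda>r. zero_ext f (X s \<omega>))"
        by (rule set_integrable_const_interval)
      from set_integral_diff(1)[OF set_integrable_path[OF s that] this]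
      show ?thesis unfolding set_integrable_def F_eq .
    qed
    have F_meas: "(\<lambda>(r, \<omega>). F r \<omega>) \<in> borel_measurable (lborel \<Otimes>\<^sub>M P i)"
    proof -
      have "(\<lambda>(r, \<omega>). zero_ext f (X (max 0 r) \<omega>)) \<in> borel_measurable (borel \<Otimes>\<^sub>M M)"
        using measurable_compose[OF X_measurable_max, of "zero_ext f" borel] by (simp add: split_beta')
      moreover have "(\<lambda>(r, \<omega>). zero_ext f (X s \<omega>)) \<in> borel_measurable (borel \<Otimes>\<^sub>M M)"
        using measurable_compose[OF measurable_snd zero_ext_X_measurable[OF s]]
        by (simp add: split_beta')
      moreover have "(\<lambda>(r, \<omega>). indicator {s..s+h} r :: real) \<in> borel_measurable (borel \<Otimes>\<^sub>M M)"
        unfolding split_beta' by (intro measurable_compose[OF measurable_fst]) auto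
      ultimately have "(\<lambda>(r, \<omega>). F r \<omega>) \<in> borel_measurable (borel \<Otimes>\<^sub>M M)"
        unfolding F_def split_beta' by (intro borel_measurable_scaleR borel_measurable_diff)
      moreover have "sets (borel \<Otimes>\<^sub>M M) = sets (lborel \<Otimes>\<^sub>M P i)"
        by (rule sets_pair_measure_cong) (simp_all add: sets_P)
      ultimately show ?thesis using measurable_cong_sets[OF _ refl] by blast
    qed
    have inner: "(\<integral>\<^sup>+\<omega>. ennreal (norm (F r \<omega>)) \<partial>P i) \<le> ennreal (C * h) * indicator {s..s+h} r" for r
    proof (cases "r \<in> {s..s+h}")
      case True
      let ?J = "{\<omega> \<in> space M. X (s + (r - s)) \<omega> \<noteq> X s \<omega>}"
      have J: "?J \<in> sets (P i)"
        unfolding sets_P using s True by (intro change_event_measurable) auto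
      have "(\<integral>\<^sup>+\<omega>. ennreal (norm (F r \<omega>)) \<partial>P i) \<le> (\<integral>\<^sup>+\<omega>. ennreal (2 * norm f) * indicator ?J \<omega> \<partial>P i)"
      proof (rule nn_integral_mono)
        fix \<omega> assume "\<omega> \<in> space (P i)"
        then show "ennreal (norm (F r \<omega>)) \<le> ennreal (2 * norm f) * indicator ?J \<omega>"
          using abs_zero_ext_le_norm[of f "X r \<omega>"] abs_zero_ext_le_norm[of f "X s \<omega>"]
          by (auto simp: F_eq indicator_def intro!: ennreal_leI)
      qed
      also have "\<dots> = ennreal (2 * norm f) * ennreal (measure (P i) ?J)"
        using J by (simp add: nn_integral_cmult emeasure_eq_measure)
      also have "\<dots> = ennreal (2 * norm f * measure (P i) ?J)"
        by (simp add: ennreal_mult)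
      also have "\<dots> \<le> ennreal (C * h)"
      proof (rule ennreal_leI)
        have "measure (P i) ?J \<le> C0 * (r - s)" using True h by (intro jump s) auto
        also have "\<dots> \<le> C0 * h" using True C0 by (intro mult_left_mono) auto
        finally show "2 * norm f * measure (P i) ?J \<le> C * h"
          unfolding C_def mult.assoc by (intro mult_left_mono) auto
      qed
      finally show ?thesis using True by simp
    next
      case False
      then show ?thesis by (simp add: F_def)
    qed
    have "(\<integral>\<^sup>+\<omega>. ennreal \<bar>\<integral>r. F r \<omega> \<partial>lborel\<bar> \<partial>P i) \<le> (\<integral>\<^sup>+\<omega>. \<integral>\<^sup>+r. ennreal (norm (F r \<omega>)) \<partial>lborel \<partial>P i)"
      using integral_norm_bound_ennreal[OF F_int] by (intro nn_integral_mono) auto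
    also have "\<dots> = (\<integral>\<^sup>+r. \<integral>\<^sup>+\<omega>. ennreal (norm (F r \<omega>)) \<partial>P i \<partial>lborel)"
      using F_meas by (intro Fubini') (simp add: split_beta')
    also have "\<dots> \<le> (\<integral>\<^sup>+r. ennreal (C * h) * indicator {s..s+h} r \<partial>lborel)"
      by (intro nn_integral_mono inner)
    also have "\<dots> = ennreal (C * h\<^sup>2)"
      using h \<open>0 \<le> C\<close> by (simp add: nn_integral_cmult ennreal_mult[symmetric] power2_eq_square mult_ac)
    finally have "(\<integral>\<omega>. \<bar>\<integral>r. F r \<omega> \<partial>lborel\<bar> \<partial>P i) \<le> C * h\<^sup>2"
      using \<open>0 \<le> C\<close> by (intro integral_real_bounded) auto
    then show "(\<integral>\<omega>. \<bar>LINT r:{s..s+h}|lborel. zero_ext f (X r \<omega>) - zero_ext f (X s \<omega>)\<bar> \<partial>P i) \<le> C * h\<^sup>2"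
      unfolding F_eq set_lebesgue_integral_def .
  qed
qed

definition riemann_sum :: "real ^ 'n \<Rightarrow> real \<Rightarrow> nat \<Rightarrow> 'a \<Rightarrow> real" where
  "riemann_sum f h n \<omega> = (\<Sum>k<n. h * zero_ext f (X (real k * h) \<omega>))"

text \<open>
  The last node of the sum is \<open>(n - 1) h\<close>, not \<open>n h\<close>; hence in the step from \<open>n h\<close> to \<open>(n + 1) h\<close> the sum
  with \<open>n + 1\<close> terms is a functional of the past. For \<open>n = 0\<close> the sum is empty and truncated subtraction is
  harmless.
\<close>

lemma riemann_sum_adapted:
  assumes "0 \<le> h"
  shows "riemann_sum f h n \<in> borel_measurable (natural_filtration M X (real (n - 1) * h))"
  unfolding riemann_sum_def
  by (intro borel_measurable_sum borel_measurable_times borel_measurable_const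
      measurable_compose[OF X_adapted, where g = "zero_ext f"])
    (use assms in \<open>auto intro!: mult_right_mono\<close>)

lemma riemann_sum_measurable:
  assumes "0 \<le> h"
  shows "riemann_sum f h n \<in> borel_measurable M"
  unfolding riemann_sum_def
  by (intro borel_measurable_sum borel_measurable_times borel_measurable_const
      zero_ext_X_measurable) (use assms in auto)

lemma riemann_sum_bound:
  assumes "0 \<le> h"
  shows "\<bar>riemann_sum f h n \<omega>\<bar> \<le> real n * h * norm f"
proof -
  have "\<bar>riemann_sum f h n \<omega>\<bar> \<le> (\<Sum>k<n. h * norm f)"
    unfolding riemann_sum_def using assms
    by (intro order_trans[OF sum_abs] sum_mono)
      (simp add: abs_mult mult_left_mono abs_zero_ext_le_norm)
  then show ?thesis by simp
qed

lemma riemann_sum_converges: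
  obtains C where "0 \<le> C"
    and "\<And>i h n. 0 \<le> h \<Longrightarrow> h \<le> 1 \<Longrightarrow>
      (\<integral>\<omega>. \<bar>path_integral f (real n * h) \<omega> - riemann_sum f h n \<omega>\<bar> \<partial>P i) \<le> real n * (C * h\<^sup>2)"
proof -
  obtain C where C: "0 \<le> C" and fluct: "\<And>i s h. 0 \<le> s \<Longrightarrow> 0 \<le> h \<Longrightarrow> h \<le> 1 \<Longrightarrow>
      (\<integral>\<omega>. \<bar>LINT r:{s..s+h}|lborel. zero_ext f (X r \<omega>) - zero_ext f (X s \<omega>)\<bar> \<partial>P i) \<le> C * h\<^sup>2"
    by (rule short_time_fluctuation[of f]) (rule that)
  show thesis
  proof
    show "0 \<le> C" by (rule C)
    fix i and h :: real and n
    assume h: "0 \<le> h" "h \<le> 1"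
    interpret prob_space "P i" by (rule prob_space_P)
    define D where "D n \<omega> = path_integral f (real n * h) \<omega> - riemann_sum f h n \<omega>" for n \<omega>
    define G where "G n \<omega> = (LINT r:{real n * h..real n * h + h}|lborel.
        zero_ext f (X r \<omega>) - zero_ext f (X (real n * h) \<omega>))" for n \<omega>
    have step: "D (Suc n) \<omega> = D n \<omega> + G n \<omega>" if \<omega>: "\<omega> \<in> space M" for n \<omega>
    proof -
      let ?t = "real n * h"
      have t: "0 \<le> ?t" using h by simp
      have "path_integral f (real (Suc n) * h) \<omega> = (LINT s:{0..?t} \<union> {?t..?t + h}|lborel. zero_ext f (X s \<omega>))"
      proof -
        have "{0..real (Suc n) * h} = {0..?t} \<union> {?t..?t + h}"
          using h t by (subst ivl_disj_un_two_touch) (auto simp: algebra_simps)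
        then show ?thesis unfolding path_integral_def by simp
      qed
      also have "\<dots> = path_integral f ?t \<omega> + (LINT s:{?t..?t + h}|lborel. zero_ext f (X s \<omega>))"
        unfolding path_integral_def
      proof (rule set_integral_Un_AE)
        show "AE s in lborel. \<not> (s \<in> {0..?t} \<and> s \<in> {?t..?t + h})"
          using AE_lborel_singleton[of ?t] by eventually_elim auto
      qed (auto intro: set_integrable_path \<omega> t)
      also have "(LINT s:{?t..?t + h}|lborel. zero_ext f (X s \<omega>)) = G n \<omega> + h * zero_ext f (X ?t \<omega>)"
        unfolding G_def using h
        by (subst set_integral_diff(2)[OF set_integrable_path[OF t \<omega>] set_integrable_const_interval])
          (simp add: set_lebesgue_integral_def)
      finally show ?thesis by (simp add: D_def riemann_sum_def)
    qed
    have Dint: "integrable (P i) (D n)" for n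
      unfolding D_def
    proof (rule integrable_bounded_P)
      show "(\<lambda>\<omega>. path_integral f (real n * h) \<omega> - riemann_sum f h n \<omega>) \<in> borel_measurable M"
        unfolding path_integral_def
        using h by (intro borel_measurable_diff path_integral_measurable riemann_sum_measurable) auto
      fix \<omega> assume "\<omega> \<in> space M"
      then show "\<bar>path_integral f (real n * h) \<omega> - riemann_sum f h n \<omega>\<bar> \<le> 2 * (real n * h * norm f)"
        using path_integral_bound[of "real n * h" \<omega> f] riemann_sum_bound[OF h(1), of f n \<omega>] h by simp
    qed
    have Gint: "integrable (P i) (G n)" for n
    proof -
      have "integrable (P i) (\<lambda>\<omega>. D (Suc n) \<omega> - D n \<omega>)"
        by (intro Bochner_Integration.integrable_diff Dint)
      then show ?thesis
        by (rule Bochner_Integration.integrable_cong[THEN iffD1, rotated -1]) (auto simp: step)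
    qed
    have "(\<integral>\<omega>. \<bar>D n \<omega>\<bar> \<partial>P i) \<le> real n * (C * h\<^sup>2)"
    proof (induction n)
      case 0
      have "AE r in lborel. indicator {0..0::real} r *\<^sub>R zero_ext f (X r \<omega>) = 0" for \<omega>
        using AE_lborel_singleton[of 0] by eventually_elim auto
      then have "path_integral f 0 \<omega> = 0" for \<omega>
        unfolding path_integral_def set_lebesgue_integral_def by (rule integral_eq_zero_AE)
      then show ?case by (simp add: D_def riemann_sum_def)
    next
      case (Suc n)
      have "(\<integral>\<omega>. \<bar>D (Suc n) \<omega>\<bar> \<partial>P i) \<le> (\<integral>\<omega>. \<bar>D n \<omega>\<bar> + \<bar>G n \<omega>\<bar> \<partial>P i)"
        by (intro integral_mono Bochner_Integration.integrable_add integrable_abs Dint Gint)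
          (auto simp: step)
      also have "\<dots> = (\<integral>\<omega>. \<bar>D n \<omega>\<bar> \<partial>P i) + (\<integral>\<omega>. \<bar>G n \<omega>\<bar> \<partial>P i)"
        by (intro Bochner_Integration.integral_add integrable_abs Dint Gint)
      also have "\<dots> \<le> real n * (C * h\<^sup>2) + C * h\<^sup>2"
        unfolding G_def[of n] by (intro add_mono Suc fluct h) (use h in simp)
      finally show ?case by (simp add: algebra_simps)
    qed
    then show "(\<integral>\<omega>. \<bar>path_integral f (real n * h) \<omega> - riemann_sum f h n \<omega>\<bar> \<partial>P i) \<le> real n * (C * h\<^sup>2)"
      by (simp add: D_def)
  qed
qed

text \<open>
  The expectation changes by a factor \<open>1 + O(h\<^sup>2)\<close> in each of the \<open>n\<close> steps and starts from \<open>u(i)\<close>. With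
  \<open>h = t / n\<close> the accumulated factor tends to \<open>1\<close>.
\<close>

lemma discrete_feynman_kac:
  assumes u: "\<And>j. 0 < u $ j"
  obtains C where "0 \<le> C"
    and "\<And>i h n. 0 \<le> h \<Longrightarrow> h \<le> 1 \<Longrightarrow>
      \<bar>(\<integral>\<omega>. exp (riemann_sum (potential Q u) h n \<omega>) * zero_ext u (X (real n * h) \<omega>) \<partial>P i) - u $ i\<bar>
        \<le> ((1 + C * h\<^sup>2) ^ n - 1) * u $ i"
proof -
  let ?V = "potential Q u"
  obtain C where C: "0 \<le> C" and near: "\<And>h j. 0 \<le> h \<Longrightarrow> h \<le> 1 \<Longrightarrow>
      \<bar>exp (h * ?V $ j) * (mat_exp (h *\<^sub>R Q) *v u) $ j - u $ j\<bar> \<le> C * h\<^sup>2 * u $ j"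
    using twisted_step_near_identity[of u Q, OF u] unfolding potential_def by auto
  show thesis
  proof
    show "0 \<le> C" by (rule C)
    fix i and h :: real and n
    assume h: "0 \<le> h" "h \<le> 1"
    interpret prob_space "P i" by (rule prob_space_P)
    define W where "W = (\<lambda>n \<omega>. exp (riemann_sum ?V h n \<omega>))"
    define a where "a n = (\<integral>\<omega>. W n \<omega> * zero_ext u (X (real n * h) \<omega>) \<partial>P i)" for n
    have nh: "0 \<le> real n * h" for n using h by simp
    have Wb: "\<bar>W n \<omega>\<bar> \<le> exp (real n * h * norm ?V)" for n \<omega>
      using riemann_sum_bound[OF h(1), of ?V n \<omega>] by (simp add: W_def)
    have Wm: "W n \<in> borel_measurable M" for n
      unfolding W_def by (rule measurable_compose[OF riemann_sum_measurable[OF h(1)] borel_measurable_exp])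
    have Wint: "integrable (P i) (\<lambda>\<omega>. W n \<omega> * zero_ext f (X (real n * h) \<omega>))" for n f
    proof (rule integrable_bounded_P)
      show "(\<lambda>\<omega>. W n \<omega> * zero_ext f (X (real n * h) \<omega>)) \<in> borel_measurable M"
        by (intro borel_measurable_times Wm zero_ext_X_measurable nh)
      show "\<bar>W n \<omega> * zero_ext f (X (real n * h) \<omega>)\<bar> \<le> exp (real n * h * norm ?V) * norm f" for \<omega>
        unfolding abs_mult by (intro mult_mono Wb abs_zero_ext_le_norm) auto
    qed
    have step: "\<bar>a (Suc n) - a n\<bar> \<le> C * h\<^sup>2 * a n" for n
    proof -
      let ?w = "\<chi> j. exp (h * ?V $ j) * (mat_exp (h *\<^sub>R Q) *v u) $ j"
      have "a (Suc n) = (\<integral>\<omega>. W (Suc n) \<omega> * zero_ext u (X (real n * h + h) \<omega>) \<partial>P i)"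
        by (simp add: a_def distrib_right add.commute)
      also have "\<dots> = (\<integral>\<omega>. W (Suc n) \<omega> * zero_ext (mat_exp (h *\<^sub>R Q) *v u) (X (real n * h) \<omega>) \<partial>P i)"
      proof (rule markov_step[OF nh h(1) _ Wb])
        show "W (Suc n) \<in> borel_measurable (natural_filtration M X (real n * h))"
          using measurable_compose[OF riemann_sum_adapted[OF h(1)] borel_measurable_exp, of ?V "Suc n"]
          unfolding W_def diff_Suc_1 .
      qed
      also have "\<dots> = (\<integral>\<omega>. W n \<omega> * zero_ext ?w (X (real n * h) \<omega>) \<partial>P i)"
      proof (rule Bochner_Integration.integral_cong[OF refl])
        fix \<omega>
        show "W (Suc n) \<omega> * zero_ext (mat_exp (h *\<^sub>R Q) *v u) (X (real n * h) \<omega>) =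
            W n \<omega> * zero_ext ?w (X (real n * h) \<omega>)"
          unfolding W_def riemann_sum_def sum.lessThan_Suc exp_add
          by (cases "X (real n * h) \<omega>") (simp_all only: zero_ext_simps vec_lambda_beta mult_ac mult_zero_right)
      qed
      finally have aS: "a (Suc n) = (\<integral>\<omega>. W n \<omega> * zero_ext ?w (X (real n * h) \<omega>) \<partial>P i)" .
      define d where "d \<omega> = W n \<omega> * zero_ext ?w (X (real n * h) \<omega>) - W n \<omega> * zero_ext u (X (real n * h) \<omega>)"
        for \<omega>
      have d: "\<bar>d \<omega>\<bar> \<le> C * h\<^sup>2 * (W n \<omega> * zero_ext u (X (real n * h) \<omega>))" for \<omega>
      proof (cases "X (real n * h) \<omega>")
        case (Some j)
        have "\<bar>W n \<omega> * (?w $ j - u $ j)\<bar> \<le> W n \<omega> * (C * h\<^sup>2 * u $ j)"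
          using near[OF h, of j] unfolding abs_mult W_def abs_exp_cancel vec_lambda_beta
          by (rule mult_left_mono) simp
        then show ?thesis
          unfolding d_def Some zero_ext_simps right_diff_distrib by (simp only: mult_ac)
      next
        case None
        then show ?thesis by (simp add: d_def)
      qed
      have dint: "integrable (P i) d"
        unfolding d_def by (rule Bochner_Integration.integrable_diff[OF Wint Wint])
      have "a (Suc n) - a n = (\<integral>\<omega>. d \<omega> \<partial>P i)"
        unfolding aS a_def[of n] d_def by (rule Bochner_Integration.integral_diff[OF Wint Wint, symmetric])
      then have "\<bar>a (Suc n) - a n\<bar> \<le> (\<integral>\<omega>. \<bar>d \<omega>\<bar> \<partial>P i)"
        using integral_abs_bound[of "P i" d] by simp
      also have "\<dots> \<le> (\<integral>\<omega>. C * h\<^sup>2 * (W n \<omega> * zero_ext u (X (real n * h) \<omega>)) \<partial>P i)"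
        by (rule integral_mono[OF integrable_abs[OF dint] integrable_mult_right[OF Wint] d])
      also have "\<dots> = C * h\<^sup>2 * a n" by (simp add: a_def)
      finally show ?thesis .
    qed
    have a0: "a 0 = u $ i"
    proof -
      have "a 0 = (\<integral>\<omega>. u $ i \<partial>P i)"
        unfolding a_def
      proof (rule integral_cong_AE)
        show "AE \<omega> in P i. W 0 \<omega> * zero_ext u (X (real 0 * h) \<omega>) = u $ i"
          using start[of i] by eventually_elim (simp add: W_def riemann_sum_def)
        show "(\<lambda>\<omega>. W 0 \<omega> * zero_ext u (X (real 0 * h) \<omega>)) \<in> borel_measurable (P i)"
          by (rule borel_measurable_integrable[OF Wint])
      qed simp
      then show ?thesis using prob_space by simp
    qed
    let ?x = "C * h\<^sup>2"
    have x: "0 \<le> ?x" using C by simp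
    have "\<bar>a n - u $ i\<bar> \<le> ((1 + ?x) ^ n - 1) * u $ i"
    proof (induction n)
      case 0
      show ?case by (simp add: a0)
    next
      case (Suc n)
      have "a n \<le> (1 + ?x) ^ n * u $ i" using Suc by (simp add: algebra_simps)
      then have "?x * a n \<le> ?x * ((1 + ?x) ^ n * u $ i)" using x by (rule mult_left_mono)
      then show ?case using Suc step[of n] by (simp add: algebra_simps)
    qed
    then show "\<bar>(\<integral>\<omega>. exp (riemann_sum ?V h n \<omega>) * zero_ext u (X (real n * h) \<omega>) \<partial>P i) - u $ i\<bar>
        \<le> ((1 + C * h\<^sup>2) ^ n - 1) * u $ i"
      by (simp add: a_def W_def)
  qed
qed

text \<open>
  The discretised expectation with \<open>h = t / N\<close> is within \<open>O(1 / N)\<close> of both sides: of the left one by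
  convergence of the Riemann sums, of the right one by the previous lemma.
\<close>

theorem feynman_kac_harmonic:
  assumes u: "\<And>j. 0 < u $ j" and t: "0 < t"
  shows "(\<integral>\<omega>. exp (path_integral (potential Q u) t \<omega>) * zero_ext u (X t \<omega>) \<partial>P i) = u $ i"
proof -
  let ?V = "potential Q u"
  interpret prob_space "P i" by (rule prob_space_P)
  obtain C where C: "0 \<le> C" and disc: "\<And>i h n. 0 \<le> h \<Longrightarrow> h \<le> 1 \<Longrightarrow>
      \<bar>(\<integral>\<omega>. exp (riemann_sum ?V h n \<omega>) * zero_ext u (X (real n * h) \<omega>) \<partial>P i) - u $ i\<bar>
        \<le> ((1 + C * h\<^sup>2) ^ n - 1) * u $ i"
    by (rule discrete_feynman_kac[OF u]) (rule that)
  obtain D where D: "0 \<le> D" and riem: "\<And>i h n. 0 \<le> h \<Longrightarrow> h \<le> 1 \<Longrightarrow>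
      (\<integral>\<omega>. \<bar>path_integral ?V (real n * h) \<omega> - riemann_sum ?V h n \<omega>\<bar> \<partial>P i) \<le> real n * (D * h\<^sup>2)"
    by (rule riemann_sum_converges[of ?V]) (rule that)
  define w where "w = (\<integral>\<omega>. exp (path_integral ?V t \<omega>) * zero_ext u (X t \<omega>) \<partial>P i)"
  define m where "m = t * norm ?V"
  define b where "b = exp m * norm u * (D * t\<^sup>2)"
  have meas: "path_integral ?V t \<in> borel_measurable M"
    using path_integral_measurable[of 0 t ?V] unfolding path_integral_def by simp
  have bound: "\<bar>w - u $ i\<bar> \<le> b / real N + (exp (C * t\<^sup>2 / real N) - 1) * u $ i"
    if N: "0 < N" "t \<le> real N" for N
  proof -
    define h where "h = t / real N"
    have h: "0 \<le> h" "h \<le> 1" "real N * h = t" using N t by (auto simp: h_def)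
    define a where "a = (\<integral>\<omega>. exp (riemann_sum ?V h N \<omega>) * zero_ext u (X t \<omega>) \<partial>P i)"
    have rb: "\<bar>riemann_sum ?V h N \<omega>\<bar> \<le> m" for \<omega>
      using riemann_sum_bound[OF h(1), of ?V N \<omega>] h(3) by (simp add: m_def)
    have pb: "\<bar>path_integral ?V t \<omega>\<bar> \<le> m" if "\<omega> \<in> space M" for \<omega>
      using path_integral_bound[of t \<omega> ?V] that t by (simp add: m_def)
    have rm: "riemann_sum ?V h N \<in> borel_measurable M" by (rule riemann_sum_measurable[OF h(1)])
    have um: "(\<lambda>\<omega>. zero_ext u (X t \<omega>)) \<in> borel_measurable M" using t by simp
    have int: "integrable (P i) (\<lambda>\<omega>. exp (Z \<omega>) * zero_ext u (X t \<omega>))"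
      if "Z \<in> borel_measurable M" "\<And>\<omega>. \<omega> \<in> space M \<Longrightarrow> \<bar>Z \<omega>\<bar> \<le> m" for Z
    proof (rule integrable_bounded_P)
      show "(\<lambda>\<omega>. exp (Z \<omega>) * zero_ext u (X t \<omega>)) \<in> borel_measurable M"
        by (intro borel_measurable_times um measurable_compose[OF that(1) borel_measurable_exp])
      fix \<omega> assume "\<omega> \<in> space M"
      with that(2)[of \<omega>] show "\<bar>exp (Z \<omega>) * zero_ext u (X t \<omega>)\<bar> \<le> exp m * norm u"
        unfolding abs_mult by (intro mult_mono abs_zero_ext_le_norm) auto
    qed
    have int2: "integrable (P i) (\<lambda>\<omega>. path_integral ?V t \<omega> - riemann_sum ?V h N \<omega>)"
    proof (rule integrable_bounded_P)
      show "(\<lambda>\<omega>. path_integral ?V t \<omega> - riemann_sum ?V h N \<omega>) \<in> borel_measurable M"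
        by (intro borel_measurable_diff meas rm)
      show "\<bar>path_integral ?V t \<omega> - riemann_sum ?V h N \<omega>\<bar> \<le> 2 * m" if "\<omega> \<in> space M" for \<omega>
        using pb[OF that] rb[of \<omega>] by simp
    qed
    have "w - a = (\<integral>\<omega>. exp (path_integral ?V t \<omega>) * zero_ext u (X t \<omega>) -
        exp (riemann_sum ?V h N \<omega>) * zero_ext u (X t \<omega>) \<partial>P i)"
      unfolding w_def a_def using int[OF meas pb] int[OF rm rb] by simp
    also have "\<bar>\<dots>\<bar> \<le> (\<integral>\<omega>. \<bar>exp (path_integral ?V t \<omega>) * zero_ext u (X t \<omega>) -
        exp (riemann_sum ?V h N \<omega>) * zero_ext u (X t \<omega>)\<bar> \<partial>P i)"
      by (rule integral_abs_bound)
    also have "\<dots> \<le> (\<integral>\<omega>. exp m * norm u * \<bar>path_integral ?V t \<omega> - riemann_sum ?V h N \<omega>\<bar> \<partial>P i)"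
    proof (rule integral_mono)
      fix \<omega> assume "\<omega> \<in> space (P i)"
      then have p: "\<bar>path_integral ?V t \<omega>\<bar> \<le> m" using pb by simp
      have "\<bar>(exp (path_integral ?V t \<omega>) - exp (riemann_sum ?V h N \<omega>)) * zero_ext u (X t \<omega>)\<bar>
          \<le> exp m * \<bar>path_integral ?V t \<omega> - riemann_sum ?V h N \<omega>\<bar> * norm u"
        unfolding abs_mult[of "_ - _"] using p rb[of \<omega>]
        by (intro mult_mono abs_exp_diff_le abs_zero_ext_le_norm) auto
      then show "\<bar>exp (path_integral ?V t \<omega>) * zero_ext u (X t \<omega>) -
          exp (riemann_sum ?V h N \<omega>) * zero_ext u (X t \<omega>)\<bar>
          \<le> exp m * norm u * \<bar>path_integral ?V t \<omega> - riemann_sum ?V h N \<omega>\<bar>"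
        unfolding left_diff_distrib by (simp only: mult_ac)
    qed (intro integrable_abs Bochner_Integration.integrable_diff integrable_mult_right int2
          int[OF meas pb] int[OF rm rb], assumption?)+
    also have "\<dots> = exp m * norm u * (\<integral>\<omega>. \<bar>path_integral ?V (real N * h) \<omega> - riemann_sum ?V h N \<omega>\<bar> \<partial>P i)"
      by (simp add: h(3))
    also have "\<dots> \<le> exp m * norm u * (real N * (D * h\<^sup>2))"
      by (intro mult_left_mono riem h) auto
    also have "\<dots> = b / real N"
      using N by (simp add: b_def h_def power2_eq_square field_simps)
    finally have 1: "\<bar>w - a\<bar> \<le> b / real N" .
    have "\<bar>a - u $ i\<bar> \<le> ((1 + C * h\<^sup>2) ^ N - 1) * u $ i"
      using disc[OF h(1,2), of i N] by (simp add: a_def h(3))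
    also have "\<dots> \<le> (exp (C * t\<^sup>2 / real N) - 1) * u $ i"
    proof (intro mult_right_mono diff_right_mono less_imp_le[OF u])
      have "(1 + C * h\<^sup>2) ^ N \<le> exp (C * h\<^sup>2) ^ N"
        using C by (intro power_mono exp_ge_add_one_self) auto
      also have "\<dots> = exp (real N * (C * h\<^sup>2))" by (rule exp_of_nat_mult[symmetric])
      also have "real N * (C * h\<^sup>2) = C * t\<^sup>2 / real N"
        using N by (simp add: h_def power2_eq_square)
      finally show "(1 + C * h\<^sup>2) ^ N \<le> exp (C * t\<^sup>2 / real N)" .
    qed
    finally have "\<bar>a - u $ i\<bar> \<le> (exp (C * t\<^sup>2 / real N) - 1) * u $ i" .
    with 1 show ?thesis by linarith
  qed
  have lim: "(\<lambda>N. b / real N + (exp (C * t\<^sup>2 / real N) - 1) * u $ i) \<longlonglongrightarrow> 0 + (exp 0 - 1) * u $ i"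
    by (intro tendsto_intros lim_const_over_n)
  obtain N0 :: nat where N0: "t \<le> real N0" using real_arch_simple by blast
  have "\<bar>w - u $ i\<bar> \<le> 0 + (exp 0 - 1) * u $ i"
  proof (rule LIMSEQ_le_const[OF lim], intro exI allI impI)
    fix N assume "Suc N0 \<le> N"
    then show "\<bar>w - u $ i\<bar> \<le> b / real N + (exp (C * t\<^sup>2 / real N) - 1) * u $ i"
      using N0 by (intro bound) auto
  qed
  then show ?thesis by (simp add: w_def)
qed

end

section \<open>The variational problem defining the rate\<close>

lemma rate_eq_SUP_potential:
  "rate Q \<mu> = (SUP u\<in>{u. \<forall>i. 0 < u $ i}. ereal (potential Q u \<bullet> \<mu>))"
proof -
  have "ereal (potential Q u \<bullet> \<mu>) = - ereal (\<Sum>i\<in>UNIV. (Q *v u) $ i / u $ i * \<mu> $ i)" for u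
    by (simp add: potential_def inner_vec_def sum_negf[symmetric])
  then show ?thesis
    unfolding rate_def by (simp only: ereal_SUP_uminus_eq)
qed

lemma potential_split:
  fixes Q :: "real ^ 'n ^ 'n::finite"
  assumes "0 < u $ i"
  shows "potential Q u $ i = - Q $ i $ i - (\<Sum>j\<in>UNIV - {i}. Q $ i $ j * (u $ j / u $ i))"
proof -
  have "(Q *v u) $ i = Q $ i $ i * u $ i + (\<Sum>j\<in>UNIV - {i}. Q $ i $ j * u $ j)"
    by (simp add: matrix_vector_mult_def sum.remove[of UNIV i])
  then show ?thesis
    using assms by (simp add: potential_def add_divide_distrib sum_divide_distrib)
qed

lemma potential_scaleR:
  assumes "c \<noteq> 0"
  shows "potential Q (c *\<^sub>R u) = potential Q u"
  using assms by (simp add: potential_def vec_eq_iff matrix_vector_mult_scaleR)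

context
  fixes Q :: "real ^ 'n ^ 'n::finite"
  assumes off_diag: "\<And>i j. i \<noteq> j \<Longrightarrow> 0 < Q $ i $ j"
begin

text \<open>
  If \<open>\<mu>\<close> charges \<open>k\<close> and the ratio \<open>u(l) / u(k)\<close> is large, the objective is very negative. For positive \<open>\<mu>\<close>
  this coercivity confines competitive \<open>u\<close>, up to scaling, to a compact set.
\<close>

lemma potential_pair_le:
  assumes u: "\<And>j. 0 < u $ j" and \<mu>: "\<And>i. 0 \<le> \<mu> $ i" and "k \<noteq> l"
  shows "potential Q u \<bullet> \<mu> \<le> (\<Sum>i\<in>UNIV. - Q $ i $ i * \<mu> $ i) - \<mu> $ k * Q $ k $ l * (u $ l / u $ k)"
proof -
  let ?s = "\<lambda>i. \<Sum>j\<in>UNIV - {i}. Q $ i $ j * (u $ j / u $ i)"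
  have pos: "0 \<le> Q $ i $ j * (u $ j / u $ i)" if "j \<in> UNIV - {i}" for i j
    using that u by (intro mult_nonneg_nonneg divide_nonneg_nonneg less_imp_le off_diag) auto
  have "Q $ k $ l * (u $ l / u $ k) \<le> ?s k"
    using \<open>k \<noteq> l\<close> pos by (intro member_le_sum[of l]) auto
  from mult_right_mono[OF this \<mu>[of k]]
  have "\<mu> $ k * Q $ k $ l * (u $ l / u $ k) \<le> ?s k * \<mu> $ k"
    by (simp only: mult_ac)
  also have "\<dots> \<le> (\<Sum>i\<in>UNIV. ?s i * \<mu> $ i)"
    by (rule member_le_sum) (simp_all only: UNIV_I finite mult_nonneg_nonneg[OF sum_nonneg[OF pos] \<mu>])
  finally show ?thesis
    by (simp add: inner_vec_def potential_split[OF u] left_diff_distrib sum_subtractf)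
qed

lemma potential_le:
  assumes u: "\<And>j. 0 < u $ j" and \<mu>: "\<And>i. 0 \<le> \<mu> $ i"
  shows "potential Q u \<bullet> \<mu> \<le> (\<Sum>i\<in>UNIV. - Q $ i $ i * \<mu> $ i)"
proof -
  have "0 \<le> (\<Sum>j\<in>UNIV - {i}. Q $ i $ j * (u $ j / u $ i))" for i
    using u by (intro sum_nonneg mult_nonneg_nonneg divide_nonneg_nonneg less_imp_le off_diag) auto
  then show ?thesis
    unfolding inner_vec_def potential_split[OF u] inner_real_def
    by (intro sum_mono mult_right_mono \<mu>) auto
qed

text \<open>
  Compare with the constant function \<open>1\<close>. By coercivity, a \<open>u\<close> that does at least as well
  has all its ratios bounded by a constant \<open>R\<close>; scaled to maximum \<open>1\<close>, it lies in the compact box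
  \<open>[1/R, 1]\<^sup>n\<close>, on which the objective is continuous.
\<close>

lemma rate_attained:
  assumes \<mu>: "\<And>i. 0 < \<mu> $ i"
  obtains u0 where "\<And>j. 0 < u0 $ j"
    and "\<And>u. (\<And>j. 0 < u $ j) \<Longrightarrow> potential Q u \<bullet> \<mu> \<le> potential Q u0 \<bullet> \<mu>"
proof -
  define A where "A = (\<Sum>i\<in>UNIV. - Q $ i $ i * \<mu> $ i)"
  define B where "B = A - potential Q (\<chi> i. 1) \<bullet> \<mu>"
  define R where "R = 1 + (\<Sum>k\<in>UNIV. \<Sum>l\<in>UNIV - {k}. B / (\<mu> $ k * Q $ k $ l))"
  have \<mu>0: "0 \<le> \<mu> $ i" for i using \<mu>[of i] by simp
  have B: "0 \<le> B" unfolding B_def A_def using potential_le[of "\<chi> i. 1" "\<mu>"] \<mu>0 by simp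
  have pos: "0 \<le> B / (\<mu> $ k * Q $ k $ l)" if "l \<in> UNIV - {k}" for k l
    using that by (intro divide_nonneg_nonneg mult_nonneg_nonneg B \<mu>0 less_imp_le off_diag) auto
  have Rge: "B / (\<mu> $ k * Q $ k $ l) \<le> R" if "k \<noteq> l" for k l
  proof -
    have "B / (\<mu> $ k * Q $ k $ l) \<le> (\<Sum>l\<in>UNIV - {k}. B / (\<mu> $ k * Q $ k $ l))"
      using that pos by (intro member_le_sum) auto
    also have "\<dots> \<le> (\<Sum>k\<in>UNIV. \<Sum>l\<in>UNIV - {k}. B / (\<mu> $ k * Q $ k $ l))"
      by (rule member_le_sum) (auto intro!: sum_nonneg pos)
    finally show ?thesis by (simp add: R_def)
  qed
  have R1: "1 \<le> R" unfolding R_def le_add_same_cancel1 by (intro sum_nonneg pos)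
  define K where "K = cbox ((\<chi> i. 1 / R) :: real ^ 'n) (\<chi> i. 1)"
  have Kpos: "0 < u $ i" if "u \<in> K" for u i
  proof -
    have "1 / R \<le> u $ i" using that by (simp add: K_def mem_box_cart)
    then show ?thesis using R1 by (smt (verit) zero_less_divide_1_iff)
  qed
  have oneK: "(\<chi> i. 1) \<in> K" using R1 by (simp add: K_def mem_box_cart)
  have cont: "continuous_on K (\<lambda>u. potential Q u \<bullet> \<mu>)"
    unfolding potential_def inner_vec_def matrix_vector_mult_def vec_lambda_beta inner_real_def
    by (intro continuous_intros ballI) (blast dest: Kpos less_imp_neq[THEN not_sym])
  obtain u0 where u0: "u0 \<in> K" "\<And>u. u \<in> K \<Longrightarrow> potential Q u \<bullet> \<mu> \<le> potential Q u0 \<bullet> \<mu>"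
    using continuous_attains_sup[OF _ _ cont] oneK unfolding K_def by (auto simp: compact_cbox)
  show thesis
  proof
    show "0 < u0 $ j" for j by (rule Kpos[OF u0(1)])
    fix u :: "real ^ 'n"
    assume u: "\<And>j. 0 < u $ j"
    show "potential Q u \<bullet> \<mu> \<le> potential Q u0 \<bullet> \<mu>"
    proof (cases "potential Q (\<chi> i. 1) \<bullet> \<mu> \<le> potential Q u \<bullet> \<mu>")
      case False
      then show ?thesis using u0(2)[OF oneK] by simp
    next
      case True
      define m where "m = Max (range (($) u))"
      have "m \<in> range (($) u)" unfolding m_def by (rule Max_in) auto
      then obtain l where l: "m = u $ l" by auto
      have m: "u $ i \<le> m" for i unfolding m_def by (rule Max_ge) auto
      have mpos: "0 < m" using u l by simp
      have "m \<le> R * u $ k" for k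
      proof (cases "k = l")
        case True
        then show ?thesis using R1 u[of k] by (simp add: l)
      next
        case False
        have c: "0 < \<mu> $ k * Q $ k $ l" using \<mu> off_diag[OF False] by simp
        have "\<mu> $ k * Q $ k $ l * (m / u $ k) \<le> B"
          using potential_pair_le[OF u \<mu>0 False] True by (simp add: B_def A_def l)
        then have "m / u $ k \<le> B / (\<mu> $ k * Q $ k $ l)"
          using c by (simp add: field_simps)
        also have "\<dots> \<le> R" by (rule Rge[OF False])
        finally show ?thesis using u[of k] by (simp add: field_simps)
      qed
      then have "(1 / m) *\<^sub>R u \<in> K"
        using R1 mpos m by (auto simp: K_def mem_box_cart field_simps)
      from u0(2)[OF this] show ?thesis using mpos by (simp add: potential_scaleR)
    qed
  qed
qed

text \<open>
  This is stationarity of the objective in the coordinate \<open>u(k)\<close>. It says that \<open>\<mu>\<close> is invariant under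
  the conservative generator with off-diagonal entries \<open>Q\<^sub>i\<^sub>j u(j) / u(i)\<close>, the Doob transform of \<open>Q\<close> by \<open>u\<close>.
\<close>

lemma maximiser_is_balanced:
  assumes u: "\<And>j. 0 < u $ j"
    and max: "\<And>v. (\<And>j. 0 < v $ j) \<Longrightarrow> potential Q v \<bullet> \<mu> \<le> potential Q u \<bullet> \<mu>"
  shows "(\<Sum>i\<in>UNIV. \<mu> $ i * Q $ i $ k / u $ i) = \<mu> $ k * (Q *v u) $ k / (u $ k)\<^sup>2"
proof -
  define v where "v s = u + s *\<^sub>R axis k 1" for s :: real
  let ?\<delta> = "\<lambda>i. if i = k then 1 else 0 :: real"
  have v: "v s $ i = u $ i + s * ?\<delta> i" for s i
    by (simp add: v_def axis_def)
  have Qv: "(Q *v v s) $ i = (Q *v u) $ i + s * Q $ i $ k" for s i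
    by (simp add: v_def matrix_vector_right_distrib matrix_vector_mult_scaleR
        matrix_vector_mult_basis column_def)
  let ?g = "\<lambda>s. \<Sum>i\<in>UNIV. - ((Q *v u) $ i + s * Q $ i $ k) / (u $ i + s * ?\<delta> i) * \<mu> $ i"
  let ?d = "\<Sum>i\<in>UNIV. - (Q $ i $ k * u $ i - (Q *v u) $ i * ?\<delta> i) / (u $ i)\<^sup>2 * \<mu> $ i"
  have g: "?g s = potential Q (v s) \<bullet> \<mu>" for s
    by (simp add: potential_def inner_vec_def v Qv)
  have "(?g has_real_derivative ?d) (at 0)"
  proof (rule DERIV_sum)
    fix i
    show "((\<lambda>s. - ((Q *v u) $ i + s * Q $ i $ k) / (u $ i + s * ?\<delta> i) * \<mu> $ i) has_real_derivative
        - (Q $ i $ k * u $ i - (Q *v u) $ i * ?\<delta> i) / (u $ i)\<^sup>2 * \<mu> $ i) (at 0)"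
      using u[of i]
      by (auto intro!: derivative_eq_intros simp: power2_eq_square divide_simps algebra_simps)
  qed
  moreover have "\<forall>s. \<bar>0 - s\<bar> < u $ k \<longrightarrow> ?g s \<le> ?g 0"
  proof (intro allI impI)
    fix s assume s: "\<bar>0 - s\<bar> < u $ k"
    have "0 < v s $ j" for j using s u[of j] by (auto simp: v)
    from max[OF this] show "?g s \<le> ?g 0" unfolding g by (simp add: v_def)
  qed
  ultimately have "?d = 0" using u[of k] by (intro DERIV_local_max[of ?g ?d 0 "u $ k"])
  moreover have "?d = - (\<Sum>i\<in>UNIV. \<mu> $ i * Q $ i $ k / u $ i) +
      (\<Sum>i\<in>UNIV. if i = k then \<mu> $ k * (Q *v u) $ k / (u $ k)\<^sup>2 else 0)"
    unfolding sum_negf[symmetric] sum.distrib[symmetric]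
  proof (rule sum.cong[OF refl])
    fix i
    show "- (Q $ i $ k * u $ i - (Q *v u) $ i * ?\<delta> i) / (u $ i)\<^sup>2 * \<mu> $ i =
        - (\<mu> $ i * Q $ i $ k / u $ i) + (if i = k then \<mu> $ k * (Q *v u) $ k / (u $ k)\<^sup>2 else 0)"
      using u[of i]
      by (cases "i = k") (simp_all add: power2_eq_square field_simps)
  qed
  ultimately show ?thesis by simp
qed

text \<open>
  Both measures are invariant for the same irreducible generator. Subtract \<open>\<nu>\<close> from the smallest multiple
  \<open>r \<mu>\<close> that dominates it: the difference is nonnegative, vanishes at some \<open>k\<close>, and the balance equation
  at \<open>k\<close> forces it to vanish at every state from which \<open>k\<close> can be entered, that is, everywhere.
\<close>

lemma maximiser_determines_measure:
  assumes u: "\<And>j. 0 < u $ j"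
    and \<mu>: "\<mu> \<in> prob_simplex" "\<And>i. 0 < \<mu> $ i"
    and \<nu>: "\<nu> \<in> prob_simplex"
    and max_\<mu>: "\<And>v. (\<And>j. 0 < v $ j) \<Longrightarrow> potential Q v \<bullet> \<mu> \<le> potential Q u \<bullet> \<mu>"
    and max_\<nu>: "\<And>v. (\<And>j. 0 < v $ j) \<Longrightarrow> potential Q v \<bullet> \<nu> \<le> potential Q u \<bullet> \<nu>"
  shows "\<nu> = \<mu>"
proof -
  define r where "r = Max (range (\<lambda>i. \<nu> $ i / \<mu> $ i))"
  have "r \<in> range (\<lambda>i. \<nu> $ i / \<mu> $ i)" unfolding r_def by (rule Max_in) auto
  then obtain k where k: "r = \<nu> $ k / \<mu> $ k" by auto
  have r: "\<nu> $ i / \<mu> $ i \<le> r" for i unfolding r_def by (rule Max_ge) auto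
  define \<kappa> where "\<kappa> i = r * \<mu> $ i - \<nu> $ i" for i
  have \<kappa>: "0 \<le> \<kappa> i" for i using r[of i] \<mu>(2)[of i] by (simp add: \<kappa>_def field_simps)
  have \<kappa>k: "\<kappa> k = 0" using \<mu>(2)[of k] by (simp add: \<kappa>_def k)
  have "(\<Sum>i\<in>UNIV. \<kappa> i * Q $ i $ k / u $ i) =
      r * (\<Sum>i\<in>UNIV. \<mu> $ i * Q $ i $ k / u $ i) - (\<Sum>i\<in>UNIV. \<nu> $ i * Q $ i $ k / u $ i)"
    by (simp add: \<kappa>_def sum_distrib_left sum_subtractf[symmetric] diff_divide_distrib
        left_diff_distrib mult.assoc)
  also have "\<dots> = \<kappa> k * (Q *v u) $ k / (u $ k)\<^sup>2"
    by (simp add: maximiser_is_balanced[OF u max_\<mu>, of k] maximiser_is_balanced[OF u max_\<nu>, of k]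
        \<kappa>_def left_diff_distrib diff_divide_distrib mult.assoc)
  also have "\<dots> = 0" by (simp add: \<kappa>k)
  finally have zero: "(\<Sum>i\<in>UNIV. \<kappa> i * Q $ i $ k / u $ i) = 0" .
  have nonneg: "0 \<le> \<kappa> i * Q $ i $ k / u $ i" for i
    using \<kappa>[of i] \<kappa>k off_diag[of i k] u[of i] by (cases "i = k") (auto intro: less_imp_le)
  have "\<kappa> i = 0" for i
  proof (cases "i = k")
    case False
    have "\<kappa> i * Q $ i $ k / u $ i = 0"
      using zero nonneg by (subst (asm) sum_nonneg_eq_0_iff) auto
    then show ?thesis using off_diag[OF False] u[of i] by simp
  qed (simp add: \<kappa>k)
  then have eq: "\<nu> $ i = r * \<mu> $ i" for i by (simp add: \<kappa>_def)
  have "1 = r * (\<Sum>i\<in>UNIV. \<mu> $ i)"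
    using \<nu> by (simp add: prob_simplex_def eq sum_distrib_left)
  then have "r = 1" using \<mu>(1) by (simp add: prob_simplex_def)
  then show ?thesis by (simp add: vec_eq_iff eq)
qed

text \<open>
  Move from \<open>\<mu>\<close> slightly towards the uniform distribution. All objectives are linear in the measure;
  at \<open>\<mu>\<close> they are uniformly below \<open>a\<close>, and at the uniform distribution they are bounded by
  the mean of the \<open>- Q\<^sub>i\<^sub>i\<close>, so they remain below \<open>a\<close> for a small displacement.
\<close>

lemma interior_approximation:
  assumes G: "openin (top_of_set prob_simplex) G" and "\<mu> \<in> G" and a: "rate Q \<mu> < ereal a"
  obtains \<nu> where "\<nu> \<in> G" "\<And>i. 0 < \<nu> $ i"
    and "\<And>u. (\<And>j. 0 < u $ j) \<Longrightarrow> potential Q u \<bullet> \<nu> < a"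
proof -
  obtain U where U: "open U" "G = prob_simplex \<inter> U"
    using G by (auto simp: openin_open)
  obtain b where b: "rate Q \<mu> < ereal b" "b < a"
    using ereal_dense2[OF a] by auto
  have \<mu>: "\<mu> \<in> prob_simplex" using \<open>\<mu> \<in> G\<close> U by auto
  have le_b: "potential Q u \<bullet> \<mu> \<le> b" if "\<And>j. 0 < u $ j" for u
  proof -
    have "ereal (potential Q u \<bullet> \<mu>) \<le> rate Q \<mu>"
      unfolding rate_eq_SUP_potential using that by (intro SUP_upper) auto
    also have "\<dots> < ereal b" by (rule b(1))
    finally show ?thesis by simp
  qed
  define \<pi> where "\<pi> = ((\<chi> i. 1 / real CARD('n)) :: real ^ 'n)"
  define A where "A = (\<Sum>i\<in>UNIV. - Q $ i $ i * \<pi> $ i)"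
  define \<nu> where "\<nu> \<theta> = (1 - \<theta>) *\<^sub>R \<mu> + \<theta> *\<^sub>R \<pi>" for \<theta> :: real
  have "(\<nu> \<longlongrightarrow> \<nu> 0) (at_right 0)"
    unfolding \<nu>_def by (intro tendsto_intros)
  then have "\<forall>\<^sub>F \<theta> in at_right 0. \<nu> \<theta> \<in> U"
    by (rule topological_tendstoD) (use U \<open>\<mu> \<in> G\<close> in \<open>auto simp: \<nu>_def\<close>)
  moreover have "((\<lambda>\<theta>. (1 - \<theta>) * b + \<theta> * A) \<longlongrightarrow> (1 - 0) * b + 0 * A) (at_right 0)"
    by (intro tendsto_intros)
  then have "\<forall>\<^sub>F \<theta> in at_right 0. (1 - \<theta>) * b + \<theta> * A < a"
    by (rule order_tendstoD(2)) (use b in simp)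
  moreover have "\<forall>\<^sub>F \<theta> in at_right 0. \<theta> < (1 :: real)"
    by (rule eventually_at_rightI[of 0 1]) auto
  moreover have "\<forall>\<^sub>F \<theta> in at_right 0. 0 < (\<theta> :: real)"
    by (rule eventually_at_rightI[of 0 1]) auto
  ultimately have "\<forall>\<^sub>F \<theta> in at_right 0. \<nu> \<theta> \<in> U \<and> (1 - \<theta>) * b + \<theta> * A < a \<and> \<theta> < 1 \<and> 0 < \<theta>"
    by eventually_elim auto
  then obtain \<theta> where \<theta>: "\<nu> \<theta> \<in> U" "(1 - \<theta>) * b + \<theta> * A < a" "\<theta> < 1" "0 < \<theta>"
    using eventually_happens'[OF trivial_limit_at_right_real] by blast
  have pos: "0 < \<nu> \<theta> $ i" for i
    using \<mu> \<theta> by (auto simp: \<nu>_def \<pi>_def prob_simplex_def intro!: add_nonneg_pos)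
  show thesis
  proof
    show "0 < \<nu> \<theta> $ i" for i by (rule pos)
    have "(\<Sum>i\<in>UNIV. \<nu> \<theta> $ i) = 1"
      using \<mu> by (simp add: \<nu>_def \<pi>_def prob_simplex_def sum.distrib sum_distrib_left[symmetric])
    then show "\<nu> \<theta> \<in> G" using \<theta>(1) pos by (auto simp: U prob_simplex_def intro: less_imp_le)
    fix u :: "real ^ 'n" assume u: "\<And>j. 0 < u $ j"
    have "potential Q u \<bullet> \<nu> \<theta> = (1 - \<theta>) * (potential Q u \<bullet> \<mu>) + \<theta> * (potential Q u \<bullet> \<pi>)"
      by (simp add: \<nu>_def inner_add_right)
    also have "\<dots> \<le> (1 - \<theta>) * b + \<theta> * A"
      unfolding A_def using \<theta>(3,4) u
      by (intro add_mono mult_left_mono le_b potential_le) (auto simp: \<pi>_def)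
    also have "\<dots> < a" by (rule \<theta>(2))
    finally show "potential Q u \<bullet> \<nu> \<theta> < a" .
  qed
qed

end

section \<open>Exponential estimates for the occupation measure\<close>

lemma compact_prob_simplex: "compact (prob_simplex :: (real ^ 'n::finite) set)"
proof (rule compact_Int_closed[of "cbox 0 (\<chi> i. 1)" "prob_simplex", THEN back_subst[of compact]])
  show "compact (cbox 0 (\<chi> i. 1) :: (real ^ 'n) set)" by (rule compact_cbox)
  have "prob_simplex = (\<Inter>i. {\<mu> :: real ^ 'n. 0 \<le> \<mu> $ i}) \<inter> {\<mu>. (\<Sum>i\<in>UNIV. \<mu> $ i) = 1}"
    by (auto simp: prob_simplex_def)
  also have "closed \<dots>"
    by (intro closed_Int closed_INT ballI closed_Collect_le closed_Collect_eq continuous_intros)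
  finally show "closed (prob_simplex :: (real ^ 'n) set)" .
  show "cbox 0 (\<chi> i. 1) \<inter> prob_simplex = (prob_simplex :: (real ^ 'n) set)"
  proof (intro Int_absorb1 subsetI)
    fix \<mu> :: "real ^ 'n" assume \<mu>: "\<mu> \<in> prob_simplex"
    have "\<mu> $ i \<le> 1" for i
      using member_le_sum[of i UNIV "($) \<mu>"] \<mu> by (auto simp: prob_simplex_def)
    then show "\<mu> \<in> cbox 0 (\<chi> i. 1)" using \<mu> by (simp add: mem_box_cart prob_simplex_def)
  qed
qed

context killed_markov_chain
begin

lemma path_integral_coordinates:
  assumes "\<omega> \<in> space M"
  shows "path_integral f t \<omega> = (\<Sum>j\<in>UNIV. f $ j * path_integral (axis j 1) t \<omega>)"
proof -
  have "path_integral f t \<omega> = (LINT s|lborel. (\<Sum>j\<in>UNIV.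
      f $ j * (indicator {0..t} s *\<^sub>R zero_ext (axis j 1) (X s \<omega>))))"
    unfolding path_integral_def set_lebesgue_integral_def zero_ext_sum[of f] zero_ext_axis
    by (simp only: real_scaleR_def sum_distrib_left mult_ac)
  also have "\<dots> = (\<Sum>j\<in>UNIV. LINT s|lborel. f $ j * (indicator {0..t} s *\<^sub>R zero_ext (axis j 1) (X s \<omega>)))"
    using set_integrable_path[OF order_refl assms, of t]
    by (intro Bochner_Integration.integral_sum integrable_mult_right) (simp add: set_integrable_def)
  also have "\<dots> = (\<Sum>j\<in>UNIV. f $ j * path_integral (axis j 1) t \<omega>)"
    by (simp add: path_integral_def set_lebesgue_integral_def)
  finally show ?thesis .
qed

lemma occupation_vec_nth: "occupation_vec X t \<omega> $ j = 1 / t * path_integral (axis j 1) t \<omega>"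
  by (simp only: occupation_vec_def occupation_def path_integral_def vec_lambda_beta zero_ext_axis
      image_insert image_empty)

text \<open>
  Exponential functionals of the path depend on it through \<open>L\<^sub>t\<close> only.
\<close>

lemma path_integral_eq_occupation:
  assumes "0 < t" "\<omega> \<in> space M"
  shows "path_integral f t \<omega> = t * (f \<bullet> occupation_vec X t \<omega>)"
  using assms
  by (simp add: path_integral_coordinates[of \<omega> f] inner_vec_def occupation_vec_nth sum_distrib_left)

lemma occupation_in_simplex:
  assumes t: "0 < t" and \<omega>: "\<omega> \<in> space M" and alive: "ereal t < \<zeta> \<omega>"
  shows "occupation_vec X t \<omega> \<in> prob_simplex"
proof -
  have "0 \<le> path_integral (axis j 1) t \<omega>" for j
    unfolding path_integral_def set_lebesgue_integral_def
    by (intro Bochner_Integration.integral_nonneg) (auto simp: zero_ext_def axis_def split: option.split)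
  moreover have "path_integral (\<chi> j. 1) t \<omega> = t"
  proof -
    have "X s \<omega> \<noteq> None" if "0 \<le> s" "s \<le> t" for s
    proof
      assume "X s \<omega> = None"
      then have "X t \<omega> = None" by (rule dead_stays_dead[OF that \<omega>])
      then show False using alive_iff[of t \<omega>] t \<omega> alive by simp
    qed
    then have "zero_ext (\<chi> j. 1) (X s \<omega>) = 1" if "0 \<le> s" "s \<le> t" for s
      using that by (auto simp: zero_ext_def split: option.split)
    then have "indicator {0..t} s *\<^sub>R zero_ext (\<chi> j. 1) (X s \<omega>) = indicator {0..t} s *\<^sub>R (1 :: real)" for s
      by (simp add: indicator_def)
    then have "path_integral (\<chi> j. 1) t \<omega> = (LINT s|lborel. indicator {0..t} s *\<^sub>R (1 :: real))"
      unfolding path_integral_def set_lebesgue_integral_def by (simp only:)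
    then show ?thesis using t by simp
  qed
  ultimately show ?thesis
    using t path_integral_coordinates[OF \<omega>, of "\<chi> j. 1" t]
    by (simp add: prob_simplex_def occupation_vec_nth sum_divide_distrib[symmetric])
qed

lemma occupation_vec_measurable: "occupation_vec X t \<in> borel_measurable M"
proof -
  have "(\<lambda>\<omega>. occupation_vec X t \<omega>) \<in> borel_measurable M"
  proof (rule borel_measurable_euclidean_space[THEN iffD2], rule ballI)
    fix b :: "real ^ 'n" assume "b \<in> Basis"
    then obtain j where "b = axis j 1" by (auto simp: Basis_vec_def)
    then have "(\<lambda>\<omega>. occupation_vec X t \<omega> \<bullet> b) = (\<lambda>\<omega>. 1 / t * path_integral (axis j 1) t \<omega>)"
      by (simp add: inner_axis occupation_vec_nth)
    then show "(\<lambda>\<omega>. occupation_vec X t \<omega> \<bullet> b) \<in> borel_measurable M"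
      using path_integral_measurable[of 0 t "axis j 1"]
      by (simp only: path_integral_def order_refl borel_measurable_times borel_measurable_const)
  qed
  then show ?thesis .
qed

definition occupation_event :: "real \<Rightarrow> (real ^ 'n) set \<Rightarrow> 'a set" where
  "occupation_event t S = {\<omega> \<in> space M. occupation_vec X t \<omega> \<in> S \<and> ereal t < \<zeta> \<omega>}"

lemma occupation_event_measurable:
  assumes "0 < t" "S \<in> sets borel"
  shows "occupation_event t S \<in> sets M"
proof -
  have "occupation_event t S = (occupation_vec X t -` S \<inter> space M) \<inter> (X t -` (- {None}) \<inter> space M)"
    using alive_iff[of t] assms(1) by (auto simp: occupation_event_def)
  also have "\<dots> \<in> sets M"
    using assms
    by (intro sets.Int measurable_sets[OF occupation_vec_measurable] measurable_sets[OF X_measurable]) simp_all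
  finally show ?thesis .
qed

text \<open>
  \<open>E\<^sub>i [exp (t \<langle>W, L\<^sub>t\<rangle>); L\<^sub>t \<in> S, t < \<zeta>]\<close>.
\<close>

definition tilted_mass :: "'n \<Rightarrow> real ^ 'n \<Rightarrow> real \<Rightarrow> (real ^ 'n) set \<Rightarrow> real" where
  "tilted_mass i W t S =
     (\<integral>\<omega>. exp (path_integral W t \<omega>) * indicator (occupation_event t S) \<omega> \<partial>P i)"

lemma exp_path_integral_integrable:
  assumes t: "0 < t" and g: "g \<in> borel_measurable M" and B: "\<And>\<omega>. \<bar>g \<omega>\<bar> \<le> B"
  shows "integrable (P i) (\<lambda>\<omega>. exp (path_integral W t \<omega>) * g \<omega>)"
proof (rule integrable_bounded_P)
  have "path_integral W t \<in> borel_measurable M"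
    using path_integral_measurable[of 0 t W] unfolding path_integral_def by simp
  then show "(\<lambda>\<omega>. exp (path_integral W t \<omega>) * g \<omega>) \<in> borel_measurable M"
    by (intro borel_measurable_times g measurable_compose[OF _ borel_measurable_exp])
  fix \<omega> assume "\<omega> \<in> space M"
  then have "\<bar>path_integral W t \<omega>\<bar> \<le> t * norm W" using t by (intro path_integral_bound) auto
  then have "exp (path_integral W t \<omega>) \<le> exp (t * norm W)" by simp
  then show "\<bar>exp (path_integral W t \<omega>) * g \<omega>\<bar> \<le> exp (t * norm W) * B"
    unfolding abs_mult abs_exp_cancel by (intro mult_mono B) auto
qed

lemma tilted_mass_integrable:
  assumes "0 < t" "S \<in> sets borel"
  shows "integrable (P i) (\<lambda>\<omega>. exp (path_integral W t \<omega>) * indicator (occupation_event t S) \<omega>)"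
  by (rule exp_path_integral_integrable[where B = 1])
    (use assms occupation_event_measurable[OF assms] in \<open>auto simp: indicator_def\<close>)

text \<open>
  Near a point \<open>\<mu>\<close> of \<open>C\<close> some potential \<open>V = potential Q u\<close> satisfies \<open>\<langle>W, \<cdot>\<rangle> < \<langle>V, \<cdot>\<rangle> - d\<close>, so the weight
  \<open>exp (t \<langle>W, L\<^sub>t\<rangle>)\<close> is there at most \<open>exp (- d t)\<close> times \<open>exp (t \<langle>V, L\<^sub>t\<rangle>)\<close>, whose expectation is bounded in \<open>t\<close>
  by the Feynman-Kac identity. Compactness reduces to finitely many pairs \<open>(u, d)\<close>.
\<close>

lemma exponential_decay:
  assumes C: "compact C" "C \<subseteq> prob_simplex"
    and better: "\<And>\<mu>. \<mu> \<in> C \<Longrightarrow> \<exists>u. (\<forall>j. 0 < u $ j) \<and> W \<bullet> \<mu> < potential Q u \<bullet> \<mu>"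
  shows "\<exists>K \<delta>. 0 < \<delta> \<and> (\<forall>t>0. \<forall>i. tilted_mass i W t C \<le> K * exp (- (\<delta> * t)))"
proof -
  define \<U> where "\<U> = {(u :: real ^ 'n, d :: real). (\<forall>j. 0 < u $ j) \<and> 0 < d}"
  define H where "H = (\<lambda>(u, d). {\<mu>. W \<bullet> \<mu> < potential Q u \<bullet> \<mu> - d})"
  have "\<And>p. p \<in> \<U> \<Longrightarrow> open (H p)"
    unfolding H_def by (auto split: prod.split intro!: open_Collect_less continuous_intros)
  moreover have "C \<subseteq> (\<Union>p\<in>\<U>. H p)"
  proof
    fix \<mu> assume "\<mu> \<in> C"
    then obtain u where u: "\<forall>j. 0 < u $ j" "W \<bullet> \<mu> < potential Q u \<bullet> \<mu>" using better by blast
    define d where "d = (potential Q u \<bullet> \<mu> - W \<bullet> \<mu>) / 2"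
    have "(u, d) \<in> \<U>" "\<mu> \<in> H (u, d)" using u by (auto simp: \<U>_def H_def d_def field_simps)
    then show "\<mu> \<in> (\<Union>p\<in>\<U>. H p)" by blast
  qed
  ultimately obtain D where D: "D \<subseteq> \<U>" "finite D" "C \<subseteq> (\<Union>p\<in>D. H p)"
    using compactE_image[OF C(1)] by metis
  \<comment> \<open>The extra element \<open>1\<close> covers the case that \<open>C\<close>, and with it \<open>D\<close>, is empty.\<close>
  define \<delta> where "\<delta> = Min (insert 1 (snd ` D))"
  have \<delta>: "0 < \<delta>" using D by (auto simp: \<delta>_def \<U>_def)
  have \<delta>_le: "\<delta> \<le> d" if "(u, d) \<in> D" for u d
    unfolding \<delta>_def using D that by (intro Min_le) force+
  define m where "m u = Min (range (($) u))" for u :: "real ^ 'n"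
  have m: "0 < m u" if "(u, d) \<in> D" for u d
    unfolding m_def using D(1) that by (subst Min_gr_iff) (auto simp: \<U>_def)
  have m_le: "m u \<le> u $ j" for u j unfolding m_def by (rule Min_le) auto
  define K where "K = (\<Sum>p\<in>D. norm (fst p) / m (fst p))"
  have "tilted_mass i W t C \<le> K * exp (- (\<delta> * t))" if t: "0 < t" for t i
  proof -
    let ?E = "\<lambda>p \<omega>. exp (- (\<delta> * t)) / m (fst p) *
        (exp (path_integral (potential Q (fst p)) t \<omega>) * zero_ext (fst p) (X t \<omega>))"
    have int: "integrable (P i) (?E p)" for p
      by (intro integrable_mult_right exp_path_integral_integrable[OF t _ abs_zero_ext_le_norm]
          zero_ext_X_measurable) (use t in simp)
    have E0: "0 \<le> ?E p \<omega>" if "p \<in> D" for p \<omega>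
    proof -
      obtain u d where p: "p = (u, d)" by (cases p)
      have "0 \<le> zero_ext u (X t \<omega>)"
        using D(1) that by (auto simp: p \<U>_def zero_ext_def intro: less_imp_le split: option.split)
      moreover have "0 < m u" using m that p by blast
      ultimately show ?thesis unfolding p fst_conv
        by (intro mult_nonneg_nonneg divide_nonneg_pos) auto
    qed
    have "tilted_mass i W t C \<le> (\<integral>\<omega>. (\<Sum>p\<in>D. ?E p \<omega>) \<partial>P i)"
      unfolding tilted_mass_def
    proof (rule integral_mono)
      show "integrable (P i) (\<lambda>\<omega>. exp (path_integral W t \<omega>) * indicator (occupation_event t C) \<omega>)"
        using C(1) by (intro tilted_mass_integrable t) (simp add: borel_closed compact_imp_closed)
      show "integrable (P i) (\<lambda>\<omega>. \<Sum>p\<in>D. ?E p \<omega>)"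
        by (intro Bochner_Integration.integrable_sum int)
      fix \<omega> assume "\<omega> \<in> space (P i)"
      then have \<omega>: "\<omega> \<in> space M" by simp
      show "exp (path_integral W t \<omega>) * indicator (occupation_event t C) \<omega> \<le> (\<Sum>p\<in>D. ?E p \<omega>)"
      proof (cases "\<omega> \<in> occupation_event t C")
        case True
        let ?L = "occupation_vec X t \<omega>"
        have "?L \<in> C" "X t \<omega> \<noteq> None"
          using True alive_iff[of t \<omega>] t by (auto simp: occupation_event_def)
        then obtain u d j where ud: "(u, d) \<in> D" "?L \<in> H (u, d)" and j: "X t \<omega> = Some j"
          using D(3) by auto
        have "\<delta> \<le> d" by (rule \<delta>_le[OF ud(1)])
        then have "W \<bullet> ?L \<le> potential Q u \<bullet> ?L - \<delta>" using ud(2) by (simp add: H_def)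
        from mult_left_mono[OF this, of t] t
        have "path_integral W t \<omega> \<le> - (\<delta> * t) + path_integral (potential Q u) t \<omega>"
          by (simp add: path_integral_eq_occupation[OF t \<omega>] algebra_simps)
        then have "exp (path_integral W t \<omega>) \<le> exp (- (\<delta> * t)) * exp (path_integral (potential Q u) t \<omega>)"
          by (simp add: exp_add[symmetric])
        also have "\<dots> = exp (- (\<delta> * t)) * exp (path_integral (potential Q u) t \<omega>) * 1" by simp
        also have "\<dots> \<le> exp (- (\<delta> * t)) * exp (path_integral (potential Q u) t \<omega>) * (u $ j / m u)"
          using m[OF ud(1)] m_le[of u j] by (intro mult_left_mono) auto
        also have "\<dots> = ?E (u, d) \<omega>" by (simp add: j)
        also have "\<dots> \<le> (\<Sum>p\<in>D. ?E p \<omega>)"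
          by (rule member_le_sum) (use ud D(2) E0 in auto)
        finally show ?thesis using True by simp
      next
        case False
        then show ?thesis using E0 by (simp add: sum_nonneg)
      qed
    qed
    also have "\<dots> = (\<Sum>p\<in>D. \<integral>\<omega>. ?E p \<omega> \<partial>P i)"
      by (rule Bochner_Integration.integral_sum[OF int])
    also have "\<dots> = (\<Sum>p\<in>D. exp (- (\<delta> * t)) / m (fst p) * fst p $ i)"
    proof (rule sum.cong[OF refl])
      fix p assume "p \<in> D"
      then have "0 < fst p $ j" for j using D(1) by (auto simp: \<U>_def)
      from feynman_kac_harmonic[OF this t, of i]
      show "(\<integral>\<omega>. ?E p \<omega> \<partial>P i) = exp (- (\<delta> * t)) / m (fst p) * fst p $ i"
        by (simp only: integral_mult_right_zero)
    qed
    also have "\<dots> \<le> (\<Sum>p\<in>D. exp (- (\<delta> * t)) / m (fst p) * norm (fst p))"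
    proof (rule sum_mono)
      fix p assume "p \<in> D"
      then have "0 < m (fst p)" using m[of "fst p" "snd p"] by simp
      moreover have "fst p $ i \<le> norm (fst p)"
        using component_le_norm_cart[of "fst p" i] by linarith
      ultimately show "exp (- (\<delta> * t)) / m (fst p) * fst p $ i \<le> exp (- (\<delta> * t)) / m (fst p) * norm (fst p)"
        by (intro mult_left_mono) auto
    qed
    also have "\<dots> = K * exp (- (\<delta> * t))"
      unfolding K_def sum_distrib_right by (rule sum.cong) simp_all
    finally show ?thesis .
  qed
  with \<delta> show ?thesis by blast
qed

text \<open>
  In the Feynman-Kac identity \<open>u(X\<^sub>t)\<close> may be replaced by its upper bound \<open>norm u\<close>.
\<close>

lemma tilted_total_mass_ge:
  assumes u: "\<And>j. 0 < u $ j" and t: "0 < t"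
  shows "u $ i / norm u \<le> tilted_mass i (potential Q u) t prob_simplex"
proof -
  let ?V = "potential Q u"
  have nu: "0 < norm u" using u[of i] by auto
  have S: "prob_simplex \<in> sets (borel :: (real ^ 'n) measure)"
    by (simp add: borel_closed compact_imp_closed compact_prob_simplex)
  have "u $ i = (\<integral>\<omega>. exp (path_integral ?V t \<omega>) * zero_ext u (X t \<omega>) \<partial>P i)"
    by (rule feynman_kac_harmonic[OF u t, symmetric])
  also have "\<dots> \<le> (\<integral>\<omega>. norm u * (exp (path_integral ?V t \<omega>) *
      indicator (occupation_event t prob_simplex) \<omega>) \<partial>P i)"
  proof (rule integral_mono)
    show "integrable (P i) (\<lambda>\<omega>. exp (path_integral ?V t \<omega>) * zero_ext u (X t \<omega>))"
      by (rule exp_path_integral_integrable[OF t _ abs_zero_ext_le_norm]) (use t in simp)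
    show "integrable (P i) (\<lambda>\<omega>. norm u * (exp (path_integral ?V t \<omega>) *
        indicator (occupation_event t prob_simplex) \<omega>))"
      by (rule integrable_mult_right[OF tilted_mass_integrable[OF t S]])
    fix \<omega> assume "\<omega> \<in> space (P i)"
    then have \<omega>: "\<omega> \<in> space M" by simp
    show "exp (path_integral ?V t \<omega>) * zero_ext u (X t \<omega>) \<le>
        norm u * (exp (path_integral ?V t \<omega>) * indicator (occupation_event t prob_simplex) \<omega>)"
    proof (cases "X t \<omega>")
      case (Some j)
      then have "\<omega> \<in> occupation_event t prob_simplex"
        using \<omega> t alive_iff[of t \<omega>] occupation_in_simplex[OF t \<omega>] by (simp add: occupation_event_def)
      moreover have "u $ j \<le> norm u" using component_le_norm_cart[of u j] by linarith
      ultimately show ?thesis by (simp add: Some mult.commute)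
    qed simp
  qed
  also have "\<dots> = norm u * tilted_mass i ?V t prob_simplex" by (simp add: tilted_mass_def)
  finally show ?thesis using nu by (simp add: field_simps)
qed

section \<open>The two large deviation bounds\<close>

text \<open>
  Every point of \<open>K\<close> has rate above \<open>a\<close>, so some potential beats the constant \<open>a\<close> there; weighting with the
  constant merely multiplies the probability by \<open>exp (a t)\<close>.
\<close>

lemma upper_bound:
  assumes K: "closedin (top_of_set prob_simplex) K" and a: "ereal a < (INF \<mu>\<in>K. rate Q \<mu>)"
  shows "\<forall>\<^sub>F t in at_top. measure (P i) (occupation_event t K) \<le> exp (- (a * t))"
proof -
  interpret prob_space "P i" by (rule prob_space_P)
  have C: "compact K" "K \<subseteq> prob_simplex"
    using K compact_prob_simplex closedin_compact closedin_imp_subset by blast+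
  have KB: "K \<in> sets borel" using C(1) by (simp add: borel_closed compact_imp_closed)
  let ?W = "(\<chi> j. a) :: real ^ 'n"
  have W: "?W \<bullet> \<mu> = a" if "\<mu> \<in> prob_simplex" for \<mu>
    using that by (simp add: inner_vec_def prob_simplex_def sum_distrib_left[symmetric])
  have "\<exists>u. (\<forall>j. 0 < u $ j) \<and> ?W \<bullet> \<mu> < potential Q u \<bullet> \<mu>" if "\<mu> \<in> K" for \<mu>
  proof -
    have "ereal a < rate Q \<mu>" using a that by (meson INF_lower order_less_le_trans)
    then obtain u where u: "\<forall>j. 0 < u $ j" "a < potential Q u \<bullet> \<mu>"
      unfolding rate_eq_SUP_potential by (auto simp: less_SUP_iff)
    have "?W \<bullet> \<mu> = a" using that C(2) by (intro W) blast
    with u show ?thesis by (intro exI[of _ u]) simp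
  qed
  from exponential_decay[OF C this] obtain A \<delta> where \<delta>: "0 < \<delta>"
    and A: "\<And>t i. 0 < t \<Longrightarrow> tilted_mass i ?W t K \<le> A * exp (- (\<delta> * t))" by blast
  have "((\<lambda>t. A * exp (- (\<delta> * t))) \<longlongrightarrow> 0) at_top"
    using \<delta> by real_asymp
  then have "\<forall>\<^sub>F t in at_top. A * exp (- (\<delta> * t)) < 1" by (rule order_tendstoD) simp
  with eventually_gt_at_top[of 0] show ?thesis
  proof eventually_elim
    case (elim t)
    have "exp (a * t) * measure (P i) (occupation_event t K) =
        (\<integral>\<omega>. exp (a * t) * indicator (occupation_event t K) \<omega> \<partial>P i)"
      using occupation_event_measurable[OF elim(1) KB] by (simp add: sets_P)
    also have "\<dots> = tilted_mass i ?W t K"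
      unfolding tilted_mass_def
    proof (rule Bochner_Integration.integral_cong[OF refl])
      fix \<omega>
      show "exp (a * t) * indicator (occupation_event t K) \<omega> =
          exp (path_integral ?W t \<omega>) * (indicator (occupation_event t K) \<omega> :: real)"
        using C W elim(1)
        by (auto simp: indicator_def occupation_event_def path_integral_eq_occupation mult.commute)
    qed
    also have "\<dots> \<le> 1" using A[OF elim(1), of i] elim(2) by linarith
    finally show ?case by (simp add: exp_minus field_simps)
  qed
qed

text \<open>
  Under the weight \<open>exp (t \<langle>V, L\<^sub>t\<rangle>)\<close>, with \<open>V\<close> the optimal potential at an interior point \<open>\<nu>\<close> of \<open>G\<close>, the mass
  outside a neighbourhood \<open>N\<close> of \<open>\<nu>\<close> decays and the total mass does not. On \<open>N\<close> the weight is at most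
  \<open>exp (b t)\<close> with \<open>b < a\<close>.
\<close>

lemma lower_bound:
  assumes off_diag: "\<And>i j. i \<noteq> j \<Longrightarrow> 0 < Q $ i $ j"
    and G: "openin (top_of_set prob_simplex) G" and "\<mu> \<in> G" and a: "rate Q \<mu> < ereal a"
  shows "\<forall>\<^sub>F t in at_top. exp (- (a * t)) \<le> measure (P i) (occupation_event t G)"
proof -
  interpret prob_space "P i" by (rule prob_space_P)
  obtain b where b: "rate Q \<mu> < ereal b" "b < a"
    using ereal_dense2[OF a] by auto
  obtain \<nu> where \<nu>: "\<nu> \<in> G" "\<And>i. 0 < \<nu> $ i"
    and \<nu>_lt: "\<And>u. (\<And>j. 0 < u $ j) \<Longrightarrow> potential Q u \<bullet> \<nu> < b"
    by (rule interior_approximation[OF off_diag G \<open>\<mu> \<in> G\<close> b(1)]) (assumption, rule that, assumption+, blast)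
  obtain u where u: "\<And>j. 0 < u $ j"
    and max: "\<And>v. (\<And>j. 0 < v $ j) \<Longrightarrow> potential Q v \<bullet> \<nu> \<le> potential Q u \<bullet> \<nu>"
    by (rule rate_attained[OF off_diag \<nu>(2)]) (assumption, rule that, assumption+, blast)
  let ?V = "potential Q u"
  obtain U where U: "open U" "G = prob_simplex \<inter> U" using G by (auto simp: openin_open)
  define N where "N = U \<inter> {\<kappa>. ?V \<bullet> \<kappa> < b}"
  have N: "open N" unfolding N_def by (intro open_Int U open_Collect_less continuous_intros)
  define C where "C = prob_simplex - N"
  have C: "compact C" unfolding C_def by (rule compact_diff[OF compact_prob_simplex N])
  have \<nu>N: "\<nu> \<in> N" "\<nu> \<in> prob_simplex" using \<nu>(1) \<nu>_lt[OF u] by (auto simp: N_def U)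
  \<comment> \<open>If no \<open>v\<close> beats \<open>u\<close> at \<open>\<kappa>\<close>, then \<open>u\<close> is optimal for \<open>\<kappa>\<close> as well as for \<open>\<nu>\<close>.\<close>
  have "\<exists>v. (\<forall>j. 0 < v $ j) \<and> ?V \<bullet> \<kappa> < potential Q v \<bullet> \<kappa>" if \<kappa>: "\<kappa> \<in> C" for \<kappa>
  proof (rule ccontr)
    assume "\<not> ?thesis"
    then have "potential Q v \<bullet> \<kappa> \<le> ?V \<bullet> \<kappa>" if "\<And>j. 0 < v $ j" for v
      using that by (meson not_less)
    then have "\<kappa> = \<nu>"
      using \<kappa> by (intro maximiser_determines_measure[OF off_diag u \<nu>N(2) \<nu>(2) _ max]) (auto simp: C_def)
    then show False using \<nu>N \<kappa> by (simp add: C_def)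
  qed
  from exponential_decay[OF C _ this] obtain A \<delta> where \<delta>: "0 < \<delta>"
    and A: "\<And>t i. 0 < t \<Longrightarrow> tilted_mass i ?V t C \<le> A * exp (- (\<delta> * t))" by (auto simp: C_def)
  define c where "c = u $ i / norm u"
  have "u \<noteq> 0" using u[of i] by auto
  then have c: "0 < c" unfolding c_def by (intro divide_pos_pos u) simp
  \<comment> \<open>Besides the decaying mass, room is made for the factor that turns \<open>exp (- b t)\<close> into \<open>exp (- a t)\<close>.\<close>
  have "((\<lambda>t. A * exp (- (\<delta> * t)) + exp (- ((a - b) * t))) \<longlongrightarrow> 0) at_top"
  proof -
    have "((\<lambda>t. B * exp (- (e * t))) \<longlongrightarrow> 0) at_top" if "0 < e" for B e :: real
      using that by real_asymp
    from tendsto_add[OF this[OF \<delta>, of A] this[of "a - b" 1]] show ?thesis using b(2) by simp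
  qed
  then have "\<forall>\<^sub>F t in at_top. A * exp (- (\<delta> * t)) + exp (- ((a - b) * t)) < c"
    using c by (rule order_tendstoD)
  with eventually_gt_at_top[of 0] show ?thesis
  proof eventually_elim
    case (elim t)
    note t = elim(1)
    have SB: "prob_simplex \<in> sets (borel :: (real ^ 'n) measure)"
      by (simp add: borel_closed compact_imp_closed compact_prob_simplex)
    have GB: "G \<in> sets borel" unfolding U(2) by (intro sets.Int SB borel_open U)
    have CB: "C \<in> sets borel" using C by (simp add: borel_closed compact_imp_closed)
    have Gev: "occupation_event t G \<in> sets (P i)"
      unfolding sets_P by (rule occupation_event_measurable[OF t GB])
    have "c \<le> tilted_mass i ?V t prob_simplex"
      unfolding c_def by (rule tilted_total_mass_ge[OF u t])
    also have "\<dots> \<le> (\<integral>\<omega>. exp (path_integral ?V t \<omega>) * indicator (occupation_event t C) \<omega>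
        + exp (b * t) * indicator (occupation_event t G) \<omega> \<partial>P i)"
      unfolding tilted_mass_def
    proof (rule integral_mono)
      show "integrable (P i) (\<lambda>\<omega>. exp (path_integral ?V t \<omega>) * indicator (occupation_event t prob_simplex) \<omega>)"
        by (rule tilted_mass_integrable[OF t SB])
      show "integrable (P i) (\<lambda>\<omega>. exp (path_integral ?V t \<omega>) * indicator (occupation_event t C) \<omega>
          + exp (b * t) * indicator (occupation_event t G) \<omega>)"
        using Gev
        by (intro Bochner_Integration.integrable_add tilted_mass_integrable[OF t CB]
            integrable_mult_right integrable_real_indicator) (auto simp: less_top[symmetric])
      fix \<omega>
      assume "\<omega> \<in> space (P i)"
      then have \<omega>: "\<omega> \<in> space M" by simp
      show "exp (path_integral ?V t \<omega>) * indicator (occupation_event t prob_simplex) \<omega>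
          \<le> exp (path_integral ?V t \<omega>) * indicator (occupation_event t C) \<omega>
            + exp (b * t) * indicator (occupation_event t G) \<omega>"
      proof (cases "\<omega> \<in> occupation_event t prob_simplex \<and> \<omega> \<notin> occupation_event t C")
        case True
        then have "occupation_vec X t \<omega> \<in> prob_simplex" "occupation_vec X t \<omega> \<in> N" "ereal t < \<zeta> \<omega>"
          using \<omega> by (auto simp: occupation_event_def C_def)
        then have "?V \<bullet> occupation_vec X t \<omega> < b" "\<omega> \<in> occupation_event t G"
          using \<omega> by (auto simp: N_def U occupation_event_def)
        then show ?thesis
          using True t by (simp add: path_integral_eq_occupation[OF t \<omega>] mult.commute)
      next
        case False
        then show ?thesis by (auto simp: indicator_def)
      qed
    qed
    also have "\<dots> = tilted_mass i ?V t C + exp (b * t) * measure (P i) (occupation_event t G)"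
      unfolding tilted_mass_def using Gev sets.sets_into_space[OF Gev]
      by (subst Bochner_Integration.integral_add)
        (auto intro!: tilted_mass_integrable[OF t CB] integrable_mult_right simp: less_top[symmetric] Int_absorb2)
    finally have "exp (- ((a - b) * t)) \<le> exp (b * t) * measure (P i) (occupation_event t G)"
      using A[OF t, of i] elim(2) by linarith
    from mult_left_mono[OF this, of "exp (- (b * t))"]
    have "exp (- (b * t)) * exp (- ((a - b) * t)) \<le> measure (P i) (occupation_event t G)"
      by (simp add: mult.assoc[symmetric] exp_add[symmetric])
    then show ?case by (simp add: exp_add[symmetric] algebra_simps)
  qed
qed

end

lemma scaled_elog_le:
  assumes "0 < t" "0 \<le> p" "p \<le> exp (- (a * t))"
  shows "ereal (1 / t) * elog p \<le> ereal (- a)"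
proof (cases "p = 0")
  case True
  then show ?thesis using assms by (simp add: elog_def)
next
  case False
  then have "ln p \<le> - (a * t)" using assms ln_le_cancel_iff[of p "exp (- (a * t))"] by simp
  then show ?thesis using False assms(1) by (simp add: elog_def field_simps)
qed

lemma scaled_elog_ge:
  assumes "0 < t" "exp (- (a * t)) \<le> p"
  shows "ereal (- a) \<le> ereal (1 / t) * elog p"
proof -
  have p: "0 < p" using assms(2) exp_gt_zero[of "- (a * t)"] by linarith
  then have "- (a * t) \<le> ln p" using assms(2) by (subst ln_ge_iff) auto
  then show ?thesis using p assms(1) by (simp add: elog_def field_simps)
qed

theorem theorem1p4:
  fixes M :: "'a measure"
    and P :: "'n::finite \<Rightarrow> 'a measure"
    and X :: "real \<Rightarrow> 'a \<Rightarrow> 'n option"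
    and \<zeta> :: "'a \<Rightarrow> ereal"
    and Q :: "real ^ 'n ^ 'n"
  assumes "CARD('n) \<ge> 2"
    and "killed_markov_chain M P X \<zeta> Q"
    and "\<And>i. 0 < - Q $ i $ i"
    and "\<And>i j. i \<noteq> j \<Longrightarrow> 0 < Q $ i $ j"
    and "\<And>i. (\<Sum>j\<in>UNIV. Q $ i $ j) \<le> 0"
  shows "(\<forall>G. openin (top_of_set prob_simplex) G \<longrightarrow>
            (\<forall>i. Liminf at_top (\<lambda>t. ereal (1 / t) *
                    elog (measure (P i) {\<omega> \<in> space M. occupation_vec X t \<omega> \<in> G \<and> ereal t < \<zeta> \<omega>}))
                 \<ge> - (INF \<mu>\<in>G. rate Q \<mu>))) \<and>
         (\<forall>K. closedin (top_of_set prob_simplex) K \<longrightarrow>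
            (\<forall>i. Limsup at_top (\<lambda>t. ereal (1 / t) *
                    elog (measure (P i) {\<omega> \<in> space M. occupation_vec X t \<omega> \<in> K \<and> ereal t < \<zeta> \<omega>}))
                 \<le> - (INF \<mu>\<in>K. rate Q \<mu>)))"
proof -
  interpret killed_markov_chain M P X \<zeta> Q by (rule assms(2))
  define p where "p i S t = measure (P i) (occupation_event t S)" for i S t
  have "- (INF \<mu>\<in>G. rate Q \<mu>) \<le> Liminf at_top (\<lambda>t. ereal (1 / t) * elog (p i G t))" (is "_ \<le> ?L")
    if G: "openin (top_of_set prob_simplex) G" for G i
  proof -
    have "- ?L \<le> rate Q \<mu>" if "\<mu> \<in> G" for \<mu>
    proof (rule ccontr)
      assume "\<not> - ?L \<le> rate Q \<mu>"
      then obtain a where a: "rate Q \<mu> < ereal a" "ereal a < - ?L"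
        using ereal_dense2 by (meson not_le)
      have "\<forall>\<^sub>F t in at_top. exp (- (a * t)) \<le> p i G t"
        unfolding p_def by (rule lower_bound[OF assms(4) G that a(1)])
      with eventually_gt_at_top[of 0]
      have "\<forall>\<^sub>F t in at_top. ereal (- a) \<le> ereal (1 / t) * elog (p i G t)"
        by eventually_elim (rule scaled_elog_ge)
      then have "ereal (- a) \<le> ?L" by (rule Liminf_bounded)
      then have "- ?L \<le> ereal a" by (simp add: ereal_uminus_le_reorder flip: uminus_ereal.simps)
      then show False using a(2) by simp
    qed
    then have "- ?L \<le> (INF \<mu>\<in>G. rate Q \<mu>)" by (rule INF_greatest)
    then show ?thesis by (simp add: ereal_uminus_le_reorder)
  qed
  moreover have "Limsup at_top (\<lambda>t. ereal (1 / t) * elog (p i K t)) \<le> - (INF \<mu>\<in>K. rate Q \<mu>)" (is "?L \<le> _")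
    if K: "closedin (top_of_set prob_simplex) K" for K i
  proof (rule ccontr)
    assume "\<not> ?thesis"
    then have "- ?L < (INF \<mu>\<in>K. rate Q \<mu>)" by (simp add: ereal_uminus_less_reorder)
    then obtain a where a: "- ?L < ereal a" "ereal a < (INF \<mu>\<in>K. rate Q \<mu>)"
      using ereal_dense2 by blast
    have "\<forall>\<^sub>F t in at_top. ereal (1 / t) * elog (p i K t) \<le> ereal (- a)"
      using upper_bound[OF K a(2), of i] eventually_gt_at_top[of 0]
      unfolding p_def by eventually_elim (rule scaled_elog_le, auto)
    then have "?L \<le> ereal (- a)" by (rule Limsup_bounded)
    then show False using a(1) by (simp add: ereal_uminus_less_reorder flip: uminus_ereal.simps)
  qed
  ultimately show ?thesis unfolding p_def occupation_event_def by blast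
qed

end
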